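(* Let $t_0\in\mathbb{R}$ and let $r>0$ be finite and fixed. Let $A(t)=\sum_{n=0}^\infty A_n(t-t_0)^n$ and $B(t)=\sum_{n=0}^\infty B_n(t-t_0)^n$ be two random power series in the $\mathrm{L}^\infty(\Omega)$ setting, for $t\in(t_0-r,t_0+r)$. Suppose that the initial conditions $Y_0$ and $Y_1$ belong to $\mathrm{L}^2(\Omega)$. Let $t\in(t_0-r,t_0+r)$. If $S_0(t)\neq0$ almost surely, if $Y_0$ is absolutely continuous with density function $f_{Y_0}$, and if $Y_0$ is independent of the rest of the random input parameters $(Y_1,A_0,A_1,\ldots,B_0,B_1,\ldots)$, then the mean square solution $X(t)$ of $$\ddot X(t)+A(t)\dot X(t)+B(t)X(t)=0,\qquad X(t_0)=Y_0,\quad \dot X(t_0)=Y_1,$$ has probability density function $$f_{X(t)}(x)=\mathbb{E}\left[f_{Y_0}\left(\frac{x-Y_1S_1(t)}{S_0(t)}\right)\frac{1}{|S_0(t)|}\right].$$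
   Context: $(\Omega,\mathcal{F},\mathbb{P})$ is a complete probability space; $\mathrm{L}^p(\Omega)$ is the Lebesgue space of real random variables with norm $\|\cdot\|_p$. A random power series $\sum_n A_n(t-t_0)^n$ is "in the $\mathrm{L}^\infty(\Omega)$ setting for $t\in(t_0-r,t_0+r)$" if $A_n\in\mathrm{L}^\infty(\Omega)$ for all $n$ and for every such $t$ the series converges in $\mathrm{L}^\infty(\Omega)$. "Mean square solution" means that the derivatives are limits in $\mathrm{L}^2(\Omega)$. $S_0(t)=\sum_{n\ge0}S_{0,n}(t-t_0)^n$ and $S_1(t)=\sum_{n\ge0}S_{1,n}(t-t_0)^n$ are the random power series, convergent in $\mathrm{L}^\infty(\Omega)$ for $t\in(t_0-r,t_0+r)$, with $S_{0,0}=1$, $S_{0,1}=0$, $S_{1,0}=0$, $S_{1,1}=1$ and, for $i\in\{0,1\}$ and $n\ge0$, $S_{i,n+2}=\frac{-1}{(n+2)(n+1)}\sum_{m=0}^n[(m+1)A_{n-m}S_{i,m+1}+B_{n-m}S_{i,m}]$. They are the $\mathrm{L}^\infty(\Omega)$ solutions of the equation with initial conditions $S_0(t_0)=1,\dot S_0(t_0)=0$ and $S_1(t_0)=0,\dot S_1(t_0)=1$. The unique mean square analytic solution is $X(t)=Y_0S_0(t)+Y_1S_1(t)$. *)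

theory Defs
  imports "HOL-Probability.Probability" "HOL-Probability.Essential_Supremum"
begin

text \<open>Elements of the Lebesgue spaces are represented by functions, which are identified only
  up to almost sure equality.\<close>

definition Linf_norm :: "'a measure \<Rightarrow> ('a \<Rightarrow> real) \<Rightarrow> ereal" where
  "Linf_norm M f = esssup M (\<lambda>\<omega>. ereal \<bar>f \<omega>\<bar>)"

definition Linf_space :: "'a measure \<Rightarrow> ('a \<Rightarrow> real) set" where
  "Linf_space M = {f \<in> borel_measurable M. Linf_norm M f < \<infinity>}"

definition L2_norm :: "'a measure \<Rightarrow> ('a \<Rightarrow> real) \<Rightarrow> real" where
  "L2_norm M f = sqrt (\<integral>\<omega>. (f \<omega>)\<^sup>2 \<partial>M)"

definition L2_space :: "'a measure \<Rightarrow> ('a \<Rightarrow> real) set" where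
  "L2_space M = {f \<in> borel_measurable M. integrable M (\<lambda>\<omega>. (f \<omega>)\<^sup>2)}"

definition Linf_sums :: "'a measure \<Rightarrow> (nat \<Rightarrow> 'a \<Rightarrow> real) \<Rightarrow> ('a \<Rightarrow> real) \<Rightarrow> bool" where
  "Linf_sums M F s \<longleftrightarrow> (\<forall>n. F n \<in> Linf_space M) \<and> s \<in> Linf_space M \<and>
     (\<lambda>N. Linf_norm M (\<lambda>\<omega>. (\<Sum>n<N. F n \<omega>) - s \<omega>)) \<longlonglongrightarrow> 0"

text \<open>\<open>Linf_suminf M F\<close> is a representative of the sum in \<open>L\<^sup>\<infinity>\<close>; it is determined only almost
  surely, and it is meaningful only if the series converges.\<close>

definition Linf_suminf :: "'a measure \<Rightarrow> (nat \<Rightarrow> 'a \<Rightarrow> real) \<Rightarrow> ('a \<Rightarrow> real)" where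
  "Linf_suminf M F = (SOME s. Linf_sums M F s)"

definition random_power_series ::
    "'a measure \<Rightarrow> (nat \<Rightarrow> 'a \<Rightarrow> real) \<Rightarrow> real \<Rightarrow> real \<Rightarrow> 'a \<Rightarrow> real" where
  "random_power_series M C t0 t = Linf_suminf M (\<lambda>n \<omega>. C n \<omega> * (t - t0) ^ n)"

definition Linf_setting :: "'a measure \<Rightarrow> (nat \<Rightarrow> 'a \<Rightarrow> real) \<Rightarrow> real \<Rightarrow> real \<Rightarrow> bool" where
  "Linf_setting M C t0 r \<longleftrightarrow> (\<forall>n. C n \<in> Linf_space M) \<and>
     (\<forall>t\<in>{t0 - r<..<t0 + r}. \<exists>s. Linf_sums M (\<lambda>n \<omega>. C n \<omega> * (t - t0) ^ n) s)"

definition has_ms_derivative ::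
    "'a measure \<Rightarrow> (real \<Rightarrow> 'a \<Rightarrow> real) \<Rightarrow> ('a \<Rightarrow> real) \<Rightarrow> real \<Rightarrow> bool" where
  "has_ms_derivative M X D t \<longleftrightarrow> D \<in> L2_space M \<and> (\<forall>\<^sub>F s in nhds t. X s \<in> L2_space M) \<and>
     ((\<lambda>h. L2_norm M (\<lambda>\<omega>. (X (t + h) \<omega> - X t \<omega>) / h - D \<omega>)) \<longlongrightarrow> 0) (at 0)"

text \<open>Mean square solution on the set \<open>I\<close> of \<open>X'' + A X' + B X = 0\<close>, \<open>X t0 = Y0\<close>, \<open>X' t0 = Y1\<close>;
  equalities between random variables are almost sure.\<close>

definition ms_solution ::
    "'a measure \<Rightarrow> real set \<Rightarrow> (real \<Rightarrow> 'a \<Rightarrow> real) \<Rightarrow> (real \<Rightarrow> 'a \<Rightarrow> real) \<Rightarrow>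
     real \<Rightarrow> ('a \<Rightarrow> real) \<Rightarrow> ('a \<Rightarrow> real) \<Rightarrow> (real \<Rightarrow> 'a \<Rightarrow> real) \<Rightarrow> bool" where
  "ms_solution M I A B t0 Y0 Y1 X \<longleftrightarrow>
     (\<exists>X' X''.
        (\<forall>t\<in>I. has_ms_derivative M X (X' t) t \<and> has_ms_derivative M X' (X'' t) t \<and>
               (AE \<omega> in M. X'' t \<omega> + A t \<omega> * X' t \<omega> + B t \<omega> * X t \<omega> = 0)) \<and>
        (AE \<omega> in M. X t0 \<omega> = Y0 \<omega>) \<and> (AE \<omega> in M. X' t0 \<omega> = Y1 \<omega>))"

text \<open>Coefficients of the power series solution with deterministic initial values \<open>c0\<close>, \<open>c1\<close>.
  \<open>S\<^sub>0\<close> has initial values 1, 0 and \<open>S\<^sub>1\<close> has initial values 0, 1.\<close>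

fun S_coeff :: "(nat \<Rightarrow> 'a \<Rightarrow> real) \<Rightarrow> (nat \<Rightarrow> 'a \<Rightarrow> real) \<Rightarrow> real \<Rightarrow> real \<Rightarrow> nat \<Rightarrow> 'a \<Rightarrow> real" where
  "S_coeff A B c0 c1 0 \<omega> = c0"
| "S_coeff A B c0 c1 (Suc 0) \<omega> = c1"
| "S_coeff A B c0 c1 (Suc (Suc n)) \<omega> =
     - 1 / (real (n + 2) * real (n + 1)) *
       (\<Sum>m=0..n. real (m + 1) * A (n - m) \<omega> * S_coeff A B c0 c1 (m + 1) \<omega>
                  + B (n - m) \<omega> * S_coeff A B c0 c1 m \<omega>)"

definition S0 ::
    "'a measure \<Rightarrow> (nat \<Rightarrow> 'a \<Rightarrow> real) \<Rightarrow> (nat \<Rightarrow> 'a \<Rightarrow> real) \<Rightarrow> real \<Rightarrow> real \<Rightarrow> 'a \<Rightarrow> real" where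
  "S0 M A B t0 t = random_power_series M (S_coeff A B 1 0) t0 t"

definition S1 ::
    "'a measure \<Rightarrow> (nat \<Rightarrow> 'a \<Rightarrow> real) \<Rightarrow> (nat \<Rightarrow> 'a \<Rightarrow> real) \<Rightarrow> real \<Rightarrow> real \<Rightarrow> 'a \<Rightarrow> real" where
  "S1 M A B t0 t = random_power_series M (S_coeff A B 0 1) t0 t"

text \<open>Independence of random elements with values in different types (the library's
  \<open>indep_var\<close> requires equal codomain types), as independence of the generated
  \<open>\<sigma>\<close>-algebras.\<close>

definition indep_elements ::
    "'a measure \<Rightarrow> 'b measure \<Rightarrow> ('a \<Rightarrow> 'b) \<Rightarrow> 'c measure \<Rightarrow> ('a \<Rightarrow> 'c) \<Rightarrow> bool" where
  "indep_elements M N U K V \<longleftrightarrow> U \<in> measurable M N \<and> V \<in> measurable M K \<and>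
     prob_space.indep_set M (sets (vimage_algebra (space M) U N))
                            (sets (vimage_algebra (space M) V K))"

end

theory Submission
  imports Defs
begin

text \<open>
The equation is linear, so its solution depends linearly on the initial values:
\<open>X(t) = Y\<^sub>0 S\<^sub>0(t) + Y\<^sub>1 S\<^sub>1(t)\<close>. Here \<open>S\<^sub>0(t)\<close> and \<open>S\<^sub>1(t)\<close> are functions of the coefficients
\<open>A\<^sub>n, B\<^sub>n\<close> only. If all parameters except \<open>Y\<^sub>0\<close> are fixed, then \<open>X(t)\<close> is a nonconstant affine function
of \<open>Y\<^sub>0\<close>, whose density is given by the change of variables formula; averaging over the other
parameters, which are independent of \<open>Y\<^sub>0\<close>, gives the claimed density
(\<open>distributed_indep_affine\<close>).

The representation of \<open>X(t)\<close> has to be proved for an arbitrary mean square solution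
(\<open>ms_solution_AE_eq\<close>). Existence of the power series solution rests on a bound for the coefficients
\<open>S\<^sub>n\<close>: convergence in \<open>L\<^sup>\<infinity>\<close> bounds \<open>\<bar>A\<^sub>n\<bar> \<rho>\<^sup>n\<close> and \<open>\<bar>B\<^sub>n\<bar> \<rho>\<^sup>n\<close> by a constant almost surely, and the
recurrence transports such a bound to \<open>\<bar>S\<^sub>n\<bar> q\<^sup>n\<close> for every \<open>q < \<rho>\<close> (\<open>S_coeff_geometric_bound\<close>). The
bound is uniform in \<open>\<omega>\<close> up to the factor \<open>\<bar>Y\<^sub>0\<bar> + \<bar>Y\<^sub>1\<bar>\<close>, which is square integrable, so the series may be
differentiated termwise in mean square (\<open>power_series_has_ms_derivative\<close>). Uniqueness follows from
Gronwall's inequality for the energy \<open>E Z\<^sup>2 + E Z'\<^sup>2\<close> of the difference \<open>Z\<close> of two solutions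
(\<open>ms_linear_ODE_zero\<close>).
\<close>

section \<open>Power series with geometrically bounded coefficients\<close>

text \<open>All power series below are controlled through one kind of hypothesis, a geometric bound on the
coefficients. The resulting estimates depend on the series only through the constant \<open>C\<close>; this is
what makes them usable with a random \<open>C\<close>, \<open>\<omega>\<close> by \<open>\<omega>\<close>.\<close>

lemma geometric_bound_summable:
  fixes c :: "nat \<Rightarrow> real"
  assumes c: "\<And>n. \<bar>c n\<bar> * q ^ n \<le> C" and q: "0 < q" and x: "\<bar>x\<bar> < q"
  shows "summable (\<lambda>n. norm (c n * x ^ n))"
    and "\<bar>\<Sum>n. c n * x ^ n\<bar> \<le> C / (1 - \<bar>x\<bar> / q)"
    and "\<bar>(\<Sum>n<N. c n * x ^ n) - (\<Sum>n. c n * x ^ n)\<bar> \<le> C * (\<bar>x\<bar> / q) ^ N / (1 - \<bar>x\<bar> / q)"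
proof -
  define y where "y = \<bar>x\<bar> / q"
  have y: "0 \<le> y" "y < 1" using q x by (auto simp: y_def)
  have le: "norm (c n * x ^ n) \<le> C * y ^ n" for n
  proof -
    have "norm (c n * x ^ n) = (\<bar>c n\<bar> * q ^ n) * y ^ n"
      using q by (simp add: y_def abs_mult power_abs power_divide)
    also have "\<dots> \<le> C * y ^ n" using c y by (intro mult_right_mono) auto
    finally show ?thesis .
  qed
  have sg: "summable (\<lambda>n. C * y ^ n)" using y by (intro summable_mult summable_geometric) auto
  show s: "summable (\<lambda>n. norm (c n * x ^ n))"
    by (rule summable_comparison_test'[OF sg, of 0]) (use le in auto)
  have s': "summable (\<lambda>n. c n * x ^ n)" using s by (rule summable_norm_cancel)
  have tail: "\<bar>\<Sum>n. c (n + N) * x ^ (n + N)\<bar> \<le> C * y ^ N / (1 - y)" for N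
  proof -
    have sN: "summable (\<lambda>n. norm (c (n + N) * x ^ (n + N)))"
      using s by (subst summable_iff_shift)
    have gN: "summable (\<lambda>n. C * y ^ (n + N))" using sg by (subst summable_iff_shift)
    have "\<bar>\<Sum>n. c (n + N) * x ^ (n + N)\<bar> \<le> (\<Sum>n. norm (c (n + N) * x ^ (n + N)))"
      using summable_norm[OF sN] by simp
    also have "\<dots> \<le> (\<Sum>n. C * y ^ (n + N))" by (rule suminf_le[OF _ sN gN]) (use le in auto)
    also have "\<dots> = (\<Sum>n. (C * y ^ N) * y ^ n)" by (simp add: power_add mult_ac)
    also have "\<dots> = C * y ^ N / (1 - y)"
      using y by (subst suminf_mult) (auto simp: suminf_geometric summable_geometric)
    finally show ?thesis .
  qed
  show "\<bar>\<Sum>n. c n * x ^ n\<bar> \<le> C / (1 - \<bar>x\<bar> / q)" using tail[of 0] by (simp add: y_def)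
  have "(\<Sum>n. c n * x ^ n) = (\<Sum>n. c (n + N) * x ^ (n + N)) + (\<Sum>n<N. c n * x ^ n)"
    using suminf_split_initial_segment[OF s'] by simp
  then show "\<bar>(\<Sum>n<N. c n * x ^ n) - (\<Sum>n. c n * x ^ n)\<bar> \<le> C * (\<bar>x\<bar> / q) ^ N / (1 - \<bar>x\<bar> / q)"
    using tail[of N] by (simp add: y_def)
qed

text \<open>The factor \<open>n + 1\<close> that differentiation produces is absorbed by shrinking the radius, because
\<open>(n + 1) y\<^sup>n \<le> 1 + y + \<dots> + y\<^sup>n \<le> 1 / (1 - y)\<close> for \<open>y = p / q\<close>.\<close>

lemma diffs_geometric_bound:
  fixes c :: "nat \<Rightarrow> real"
  assumes c: "\<And>n. \<bar>c n\<bar> * q ^ n \<le> C" and p: "0 < p" "p < q"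
  shows "\<bar>diffs c n\<bar> * p ^ n \<le> C / (q - p)"
proof -
  define y where "y = p / q"
  have y: "0 < y" "y < 1" using p by (auto simp: y_def)
  have C: "0 \<le> C" using c[of 0] by simp
  have "(real n + 1) * y ^ n = (\<Sum>k\<le>n. y ^ n)" by simp
  also have "\<dots> \<le> (\<Sum>k\<le>n. y ^ k)" using y by (intro sum_mono power_decreasing) auto
  also have "\<dots> \<le> 1 / (1 - y)"
    using y by (simp add: sum_gp0 divide_right_mono)
  finally have b: "(real n + 1) * y ^ n \<le> 1 / (1 - y)" .
  have "\<bar>diffs c n\<bar> * p ^ n = (\<bar>c (Suc n)\<bar> * q ^ Suc n) * ((real n + 1) * y ^ n) / q"
  proof -
    have "\<bar>diffs c n\<bar> = (real n + 1) * \<bar>c (Suc n)\<bar>"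
      unfolding diffs_def abs_mult by simp
    then show ?thesis using p by (simp add: y_def power_divide)
  qed
  also have "\<dots> \<le> C * (1 / (1 - y)) / q"
    using b c[of "Suc n"] C p y by (intro divide_right_mono mult_mono) auto
  also have "\<dots> = C / (q - p)" using p by (simp add: y_def field_simps)
  finally show ?thesis .
qed

lemma geometric_bound_DERIV:
  fixes c :: "nat \<Rightarrow> real"
  assumes c: "\<And>n. \<bar>c n\<bar> * q ^ n \<le> C" and x: "\<bar>x\<bar> < q"
  shows "((\<lambda>x. \<Sum>n. c n * x ^ n) has_field_derivative (\<Sum>n. diffs c n * x ^ n)) (at x)"
proof (rule termdiffs_strong'[where K = q])
  fix z :: real assume "norm z < q"
  then show "summable (\<lambda>n. c n * z ^ n)"
    using geometric_bound_summable(1)[OF c, of z] by (auto intro: summable_norm_cancel)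
qed (use x in auto)

text \<open>Taylor's formula with a remainder constant that is the same for all series: the second derivative is
bounded on \<open>[-p, p]\<close> by a multiple of \<open>C\<close>, and the mean value inequality is applied twice. Linearity
of the remainder in \<open>C\<close> is what turns the estimate into one for \<open>L\<^sup>2\<close> norms later on.\<close>

lemma power_series_second_order_remainder:
  fixes p q :: real
  assumes p: "0 < p" "p < q"
  obtains L where "0 \<le> L"
    "\<And>c C x h. (\<And>n. \<bar>c n\<bar> * q ^ n \<le> C) \<Longrightarrow> \<bar>x\<bar> \<le> p \<Longrightarrow> \<bar>x + h\<bar> \<le> p \<Longrightarrow>
       \<bar>(\<Sum>n. c n * (x + h) ^ n) - (\<Sum>n. c n * x ^ n) - h * (\<Sum>n. diffs c n * x ^ n)\<bar> \<le> L * C * h\<^sup>2"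
proof -
  \<comment> \<open>Each of the two differentiations costs some radius.\<close>
  define p1 where "p1 = (p + q) / 2"
  define p2 where "p2 = (p1 + q) / 2"
  have pp: "0 < p1" "p < p1" "p1 < p2" "p2 < q" "0 < p2"
    using p by (auto simp: p1_def p2_def field_simps)
  define L where "L = 1 / (q - p2) / (p2 - p1) / (1 - p / p1)"
  show thesis
  proof (rule that[of L])
    show "0 \<le> L" using pp p by (auto simp: L_def)
    fix c :: "nat \<Rightarrow> real" and C x h :: real
    assume c: "\<And>n. \<bar>c n\<bar> * q ^ n \<le> C" and x: "\<bar>x\<bar> \<le> p" and xh: "\<bar>x + h\<bar> \<le> p"
    have C: "0 \<le> C" using c[of 0] by simp
    have c1: "\<bar>diffs c n\<bar> * p2 ^ n \<le> C / (q - p2)" for n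
      by (rule diffs_geometric_bound[OF c pp(5,4)])
    have c2: "\<bar>diffs (diffs c) n\<bar> * p1 ^ n \<le> C / (q - p2) / (p2 - p1)" for n
      by (rule diffs_geometric_bound[OF c1 pp(1,3)])
    define f where "f = (\<lambda>x. \<Sum>n. c n * x ^ n)"
    define f1 where "f1 = (\<lambda>x. \<Sum>n. diffs c n * x ^ n)"
    define f2 where "f2 = (\<lambda>x. \<Sum>n. diffs (diffs c) n * x ^ n)"
    have df: "(f has_field_derivative f1 z) (at z)" if "\<bar>z\<bar> \<le> p" for z
      unfolding f_def f1_def by (rule geometric_bound_DERIV[OF c]) (use that p in linarith)
    have df1: "(f1 has_field_derivative f2 z) (at z)" if "\<bar>z\<bar> \<le> p" for z
      unfolding f1_def f2_def by (rule geometric_bound_DERIV[OF c1]) (use that pp in linarith)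
    have bf2: "\<bar>f2 z\<bar> \<le> L * C" if "\<bar>z\<bar> \<le> p" for z
    proof -
      let ?a = "C / (q - p2) / (p2 - p1)"
      have a: "0 \<le> ?a" using C pp by (intro divide_nonneg_nonneg) linarith+
      have z: "\<bar>z\<bar> / p1 \<le> p / p1" using that pp(1) by (intro divide_right_mono) linarith+
      have p1: "p / p1 < 1" using pp(1,2) by simp
      have "\<bar>f2 z\<bar> \<le> ?a / (1 - \<bar>z\<bar> / p1)"
        unfolding f2_def by (rule geometric_bound_summable(2)[OF c2 pp(1)]) (use that pp(2) in linarith)
      also have "\<dots> \<le> ?a / (1 - p / p1)"
      proof (rule divide_left_mono[OF _ a])
        show "1 - p / p1 \<le> 1 - \<bar>z\<bar> / p1" using z by linarith
        show "0 < (1 - \<bar>z\<bar> / p1) * (1 - p / p1)"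
          by (rule mult_pos_pos) (use z p1 in linarith)+
      qed
      also have "\<dots> = L * C" by (simp only: L_def times_divide_eq_left mult_1)
      finally show ?thesis .
    qed
    define S where "S = cball x \<bar>h\<bar> \<inter> {-p..p}"
    have S: "convex S" unfolding S_def by (intro convex_Int convex_cball convex_real_interval)
    have xS: "x \<in> S" "x + h \<in> S" using x xh by (simp_all add: S_def dist_real_def abs_le_iff)
    have S': "\<bar>z\<bar> \<le> p" "\<bar>z - x\<bar> \<le> \<bar>h\<bar>" if "z \<in> S" for z
    proof -
      have "dist x z \<le> \<bar>h\<bar>" "- p \<le> z" "z \<le> p" using that by (simp_all add: S_def)
      then show "\<bar>z\<bar> \<le> p" "\<bar>z - x\<bar> \<le> \<bar>h\<bar>" unfolding dist_real_def by linarith+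
    qed
    have b1: "\<bar>f1 z - f1 x\<bar> \<le> L * C * \<bar>h\<bar>" if z: "z \<in> S" for z
    proof -
      have "norm (f1 z - f1 x) \<le> (L * C) * norm (z - x)"
      proof (rule field_differentiable_bound[OF S _ _ z xS(1)])
        fix u assume u: "u \<in> S"
        show "(f1 has_field_derivative f2 u) (at u within S)"
          by (rule has_field_derivative_at_within[OF df1[OF S'(1)[OF u]]])
        show "norm (f2 u) \<le> L * C" using bf2[OF S'(1)[OF u]] by simp
      qed
      also have "\<dots> \<le> L * C * \<bar>h\<bar>"
        using S'(2)[OF z] bf2[of 0] p by (intro mult_left_mono) auto
      finally show ?thesis by simp
    qed
    have "norm ((f (x + h) - (x + h) * f1 x) - (f x - x * f1 x)) \<le> (L * C * \<bar>h\<bar>) * norm (x + h - x)"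
    proof (rule field_differentiable_bound[OF S _ _ xS(2,1)])
      fix u assume u: "u \<in> S"
      have "((\<lambda>z. f z - z * f1 x) has_field_derivative f1 u - 1 * f1 x) (at u)"
        by (rule DERIV_diff[OF df[OF S'(1)[OF u]] DERIV_cmult_right[OF DERIV_ident]])
      then show "((\<lambda>z. f z - z * f1 x) has_field_derivative f1 u - f1 x) (at u within S)"
        unfolding mult_1 by (rule has_field_derivative_at_within)
      show "norm (f1 u - f1 x) \<le> L * C * \<bar>h\<bar>" using b1[OF u] by simp
    qed
    also have "(f (x + h) - (x + h) * f1 x) - (f x - x * f1 x) = f (x + h) - f x - h * f1 x"
      by (simp add: algebra_simps)
    finally show "\<bar>(\<Sum>n. c n * (x + h) ^ n) - (\<Sum>n. c n * x ^ n) - h * (\<Sum>n. diffs c n * x ^ n)\<bar> \<le> L * C * h\<^sup>2"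
      unfolding f_def f1_def by (simp add: power2_eq_square mult.assoc)
  qed
qed

section \<open>Coefficients of the power series solution\<close>

text \<open>The product of the factors \<open>max 1 (E / k)\<close> stays bounded since all but finitely many factors equal 1.
Such weights close an induction in which the step from \<open>n\<close> to \<open>n + 1\<close> loses a factor \<open>E / (n + 1)\<close>.\<close>

lemma bounded_weights:
  fixes E :: real
  assumes E: "0 \<le> E"
  obtains w C where "w 0 = 1" "\<And>n::nat. 1 \<le> w n" "\<And>n. w n \<le> C" "mono w"
    "\<And>n. E / real (Suc n) * w n \<le> w (Suc n)"
proof -
  define w where "w = (\<lambda>n. \<Prod>k<n. max 1 (E / real (Suc k)))"
  have w0: "w 0 = 1" by (simp add: w_def)
  have wS: "w (Suc n) = max 1 (E / real (Suc n)) * w n" for n by (simp add: w_def mult.commute)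
  have w1: "1 \<le> w n" for n unfolding w_def by (rule prod_ge_1) auto
  have wm: "w n \<le> w (Suc n)" for n
    using mult_right_mono[of 1 "max 1 (E / real (Suc n))" "w n"] w1[of n] by (auto simp: wS)
  have mono: "mono w" using wm by (rule incseq_SucI)
  obtain N :: nat where N: "E \<le> real N" using real_arch_simple by blast
  have const: "w (N + k) = w N" for k
  proof (induction k)
    case (Suc k)
    have "E / real (Suc (N + k)) \<le> 1" using N by (simp add: field_simps)
    then show ?case using Suc wS[of "N + k"] by (simp add: max_def)
  qed auto
  have "w n \<le> w N" for n
    using monoD[OF mono, of n "N + n"] const[of n] by simp
  moreover have "E / real (Suc n) * w n \<le> w (Suc n)" for n
    unfolding wS by (intro mult_right_mono) (use w1[of n] in auto)
  ultimately show thesis using that[of w "w N"] w0 w1 mono by blast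
qed

text \<open>If the bound holds with weights \<open>w\<close> up to index \<open>n + 1\<close>, then the recurrence, multiplied by
\<open>q\<^sup>n\<^sup>+\<^sup>2\<close>, bounds the next coefficient by \<open>E w(n + 1) / (n + 2)\<close>: the sum over \<open>m\<close> is dominated by
the geometric series in \<open>q / \<rho>\<close>, and the factor \<open>m + 1 \<le> n + 1\<close> cancels against the denominator
\<open>(n + 2) (n + 1)\<close>. The constant \<open>C\<close> depends on \<open>K\<close>, \<open>q\<close> and \<open>\<rho>\<close> only, so the bound is uniform in \<open>\<omega>\<close>;
the initial values \<open>c0\<close>, \<open>c1\<close> enter linearly and may be random.\<close>

lemma S_coeff_geometric_bound:
  fixes K q \<rho> :: real
  assumes q: "0 < q" "q < \<rho>" and K: "0 \<le> K"
  obtains C where "0 \<le> C"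
    "\<And>(A :: nat \<Rightarrow> 'a \<Rightarrow> real) B c0 c1 \<omega> n. (\<And>n. \<bar>A n \<omega>\<bar> * \<rho> ^ n \<le> K) \<Longrightarrow> (\<And>n. \<bar>B n \<omega>\<bar> * \<rho> ^ n \<le> K) \<Longrightarrow>
       \<bar>S_coeff A B c0 c1 n \<omega>\<bar> * q ^ n \<le> C * (\<bar>c0\<bar> + \<bar>c1\<bar>)"
proof -
  define x where "x = q / \<rho>"
  have x: "0 < x" "x < 1" using q by (auto simp: x_def)
  define E where "E = K * (q + q\<^sup>2) / (1 - x)"
  have E: "0 \<le> E" using K q x by (auto simp: E_def)
  obtain w C where w: "w 0 = 1" "\<And>n::nat. 1 \<le> w n" "\<And>n. w n \<le> C" "mono w"
    "\<And>n. E / real (Suc n) * w n \<le> w (Suc n)"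
    using bounded_weights[OF E] by blast
  have C: "1 \<le> C" using w(1) w(3)[of 0] by simp
  show thesis
  proof (rule that[of "C * (1 + q)"])
    show "0 \<le> C * (1 + q)" using C q by auto
    fix A B :: "nat \<Rightarrow> 'a \<Rightarrow> real" and c0 c1 \<omega> n
    assume A: "\<And>n. \<bar>A n \<omega>\<bar> * \<rho> ^ n \<le> K" and B: "\<And>n. \<bar>B n \<omega>\<bar> * \<rho> ^ n \<le> K"
    define D where "D = \<bar>c0\<bar> + \<bar>c1\<bar> * q"
    have D: "0 \<le> D" using q by (simp add: D_def)
    let ?S = "\<lambda>n. S_coeff A B c0 c1 n \<omega>"
    have scale: "a * q ^ n \<le> K * x ^ n" if "a * \<rho> ^ n \<le> K" for a n
    proof -
      have "a * q ^ n = (a * \<rho> ^ n) * x ^ n" using q by (simp add: x_def power_divide)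
      also have "\<dots> \<le> K * x ^ n" by (rule mult_right_mono[OF that]) (use x in simp)
      finally show ?thesis .
    qed
    note Aq = scale[OF A] and Bq = scale[OF B]
    have main: "\<bar>?S n\<bar> * q ^ n \<le> D * w n" for n
    proof (induction n rule: less_induct)
      case (less n)
      consider "n = 0" | "n = 1" | k where "n = Suc (Suc k)"
        by (metis One_nat_def not0_implies_Suc)
      then show ?case
      proof cases
        case 1 then show ?thesis using q w(1) by (simp add: D_def)
      next
        case 2
        have "\<bar>?S n\<bar> * q ^ n \<le> D * 1" using 2 q by (simp add: D_def)
        also have "\<dots> \<le> D * w n" using D w(2) by (intro mult_left_mono) auto
        finally show ?thesis .
      next
        case (3 k)
        let ?F = "\<lambda>m. real (m + 1) * A (k - m) \<omega> * ?S (m + 1) + B (k - m) \<omega> * ?S m"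
        have IH: "\<bar>?S m\<bar> * q ^ m \<le> D * w (Suc k)" if "m \<le> Suc k" for m
        proof -
          have "\<bar>?S m\<bar> * q ^ m \<le> D * w m" using that 3 by (intro less) auto
          also have "\<dots> \<le> D * w (Suc k)" using D monoD[OF w(4) that] by (intro mult_left_mono) auto
          finally show ?thesis .
        qed
        have trm: "\<bar>?F m\<bar> * q ^ (k + 2) \<le> (real k + 1) * (K * (q + q\<^sup>2) * D * w (Suc k)) * x ^ (k - m)"
          if m: "m \<le> k" for m
        proof -
          have e1: "q ^ (k + 2) = q * (q ^ (k - m) * q ^ (m + 1))"
            and e2: "q ^ (k + 2) = q\<^sup>2 * (q ^ (k - m) * q ^ m)"
            using m by (simp_all flip: power_add power_Suc)
          have a: "(\<bar>A (k - m) \<omega>\<bar> * q ^ (k - m)) * (\<bar>?S (m + 1)\<bar> * q ^ (m + 1)) \<le> (K * x ^ (k - m)) * (D * w (Suc k))"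
            using K x q m by (intro mult_mono[OF Aq IH]) auto
          have b: "(\<bar>B (k - m) \<omega>\<bar> * q ^ (k - m)) * (\<bar>?S m\<bar> * q ^ m) \<le> (K * x ^ (k - m)) * (D * w (Suc k))"
            using K x q m by (intro mult_mono[OF Bq IH]) auto
          have nn: "0 \<le> (K * x ^ (k - m)) * (D * w (Suc k))"
            using K x D w(2)[of "Suc k"] by (intro mult_nonneg_nonneg) auto
          have "\<bar>?F m\<bar> * q ^ (k + 2) \<le> (real (m + 1) * (\<bar>A (k - m) \<omega>\<bar> * \<bar>?S (m + 1)\<bar>) + \<bar>B (k - m) \<omega>\<bar> * \<bar>?S m\<bar>) * q ^ (k + 2)"
            using q by (intro mult_right_mono order.trans[OF abs_triangle_ineq]) (auto simp: abs_mult)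
          also have "\<dots> = real (m + 1) * (\<bar>A (k - m) \<omega>\<bar> * \<bar>?S (m + 1)\<bar>) * q ^ (k + 2) + \<bar>B (k - m) \<omega>\<bar> * \<bar>?S m\<bar> * q ^ (k + 2)"
            by (rule distrib_right)
          also have "\<dots> = real (m + 1) * q * ((\<bar>A (k - m) \<omega>\<bar> * q ^ (k - m)) * (\<bar>?S (m + 1)\<bar> * q ^ (m + 1)))
                 + q\<^sup>2 * ((\<bar>B (k - m) \<omega>\<bar> * q ^ (k - m)) * (\<bar>?S m\<bar> * q ^ m))"
            by (subst (1) e1, subst (1) e2) (simp add: mult_ac)
          also have "\<dots> \<le> (real k + 1) * q * ((K * x ^ (k - m)) * (D * w (Suc k)))
                 + ((real k + 1) * q\<^sup>2) * ((K * x ^ (k - m)) * (D * w (Suc k)))"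
          proof (rule add_mono)
            show "real (m + 1) * q * ((\<bar>A (k - m) \<omega>\<bar> * q ^ (k - m)) * (\<bar>?S (m + 1)\<bar> * q ^ (m + 1)))
              \<le> (real k + 1) * q * ((K * x ^ (k - m)) * (D * w (Suc k)))"
              by (rule mult_mono[OF _ a]) (use q m in auto)
            have "q\<^sup>2 \<le> (real k + 1) * q\<^sup>2" using mult_right_mono[of 1 "real k + 1" "q\<^sup>2"] by simp
            then show "q\<^sup>2 * ((\<bar>B (k - m) \<omega>\<bar> * q ^ (k - m)) * (\<bar>?S m\<bar> * q ^ m))
              \<le> ((real k + 1) * q\<^sup>2) * ((K * x ^ (k - m)) * (D * w (Suc k)))"
              by (rule mult_mono[OF _ b]) (use q in auto)
          qed
          also have "\<dots> = (real k + 1) * (K * (q + q\<^sup>2) * D * w (Suc k)) * x ^ (k - m)"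
            by (simp add: algebra_simps)
          finally show ?thesis .
        qed
        have gs: "(\<Sum>m=0..k. x ^ (k - m)) \<le> 1 / (1 - x)"
        proof -
          have "(\<Sum>m=0..k. x ^ (k - m)) = (\<Sum>m\<le>k. x ^ m)"
            using sum.atLeastAtMost_rev[of "\<lambda>i. x ^ i" 0 k] by (simp add: atLeast0AtMost)
          also have "\<dots> \<le> 1 / (1 - x)" using x by (simp add: sum_gp0 divide_right_mono)
          finally show ?thesis .
        qed
        have "\<bar>\<Sum>m=0..k. ?F m\<bar> * q ^ (k + 2) \<le> (\<Sum>m=0..k. \<bar>?F m\<bar>) * q ^ (k + 2)"
          using q by (intro mult_right_mono sum_abs) auto
        also have "\<dots> = (\<Sum>m=0..k. \<bar>?F m\<bar> * q ^ (k + 2))" by (rule sum_distrib_right)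
        also have "\<dots> \<le> (\<Sum>m=0..k. (real k + 1) * (K * (q + q\<^sup>2) * D * w (Suc k)) * x ^ (k - m))"
          by (intro sum_mono trm) auto
        also have "\<dots> = (real k + 1) * (K * (q + q\<^sup>2) * D * w (Suc k)) * (\<Sum>m=0..k. x ^ (k - m))"
          by (rule sum_distrib_left[symmetric])
        also have "\<dots> \<le> (real k + 1) * (K * (q + q\<^sup>2) * D * w (Suc k)) * (1 / (1 - x))"
          using gs K q D w(2)[of "Suc k"] by (intro mult_left_mono mult_nonneg_nonneg) auto
        also have "\<dots> = (real k + 1) * (E * D * w (Suc k))" by (simp add: E_def)
        finally have F: "\<bar>\<Sum>m=0..k. ?F m\<bar> * q ^ (k + 2) \<le> (real k + 1) * (E * D * w (Suc k))" .
        have "?S n = - 1 / (real (k + 2) * real (k + 1)) * (\<Sum>m=0..k. ?F m)" unfolding 3 by (rule S_coeff.simps(3))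
        then have "\<bar>?S n\<bar> * q ^ n = (\<bar>\<Sum>m=0..k. ?F m\<bar> * q ^ (k + 2)) / (real (k + 2) * real (k + 1))"
          using 3 by (simp add: abs_mult)
        also have "\<dots> \<le> (real k + 1) * (E * D * w (Suc k)) / (real (k + 2) * real (k + 1))"
          using F by (intro divide_right_mono) auto
        also have "\<dots> = D * (E / real (Suc (Suc k)) * w (Suc k))"
        proof -
          have "a * Z / (b * a) = Z / b" if "a \<noteq> 0" for a b Z :: real using that by simp
          from this[of "real k + 1" "E * D * w (Suc k)" "real (k + 2)"] show ?thesis by (simp add: add_ac mult_ac)
        qed
        also have "\<dots> \<le> D * w n" using D w(5)[of "Suc k"] 3 by (intro mult_left_mono) auto
        finally show ?thesis .
      qed
    qed
    have "\<bar>?S n\<bar> * q ^ n \<le> D * C" using main[of n] mult_left_mono[OF w(3)[of n] D] by linarith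
    also have "\<dots> \<le> ((1 + q) * (\<bar>c0\<bar> + \<bar>c1\<bar>)) * C"
      using C q by (intro mult_right_mono) (auto simp: D_def algebra_simps)
    finally show "\<bar>?S n\<bar> * q ^ n \<le> C * (1 + q) * (\<bar>c0\<bar> + \<bar>c1\<bar>)" by (simp add: mult_ac)
  qed
qed

lemma S_coeff_linear:
  "S_coeff A B c0 c1 n \<omega> = c0 * S_coeff A B 1 0 n \<omega> + c1 * S_coeff A B 0 1 n \<omega>"
proof (induction n rule: less_induct)
  case (less n)
  consider "n = 0" | "n = 1" | k where "n = Suc (Suc k)"
    by (metis One_nat_def not0_implies_Suc)
  then show ?case
  proof cases
    case (3 k)
    have IH: "S_coeff A B c0 c1 m \<omega> = c0 * S_coeff A B 1 0 m \<omega> + c1 * S_coeff A B 0 1 m \<omega>" if "m \<le> k + 1" for m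
      using that 3 by (intro less) auto
    have "(\<Sum>m=0..k. real (m + 1) * A (k - m) \<omega> * S_coeff A B c0 c1 (m + 1) \<omega> + B (k - m) \<omega> * S_coeff A B c0 c1 m \<omega>)
      = (\<Sum>m=0..k. c0 * (real (m + 1) * A (k - m) \<omega> * S_coeff A B 1 0 (m + 1) \<omega> + B (k - m) \<omega> * S_coeff A B 1 0 m \<omega>)
          + c1 * (real (m + 1) * A (k - m) \<omega> * S_coeff A B 0 1 (m + 1) \<omega> + B (k - m) \<omega> * S_coeff A B 0 1 m \<omega>))"
      by (intro sum.cong refl) (simp add: IH algebra_simps)
    then show ?thesis unfolding 3 S_coeff.simps(3) sum.distrib sum_distrib_left[symmetric]
      by (simp add: algebra_simps add_divide_distrib)
  qed auto
qed

text \<open>A coefficient at \<open>\<omega>\<close> depends only on the numbers \<open>A n \<omega>\<close> and \<open>B n \<omega>\<close>. It can therefore be read as a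
function on the space of coefficient sequences, which is how independence will be applied.\<close>

lemma S_coeff_cong:
  assumes "\<And>n. A n \<omega> = A' n \<omega>'" "\<And>n. B n \<omega> = B' n \<omega>'"
  shows "S_coeff A B c0 c1 n \<omega> = S_coeff A' B' c0 c1 n \<omega>'"
proof (induction n rule: less_induct)
  case (less n)
  consider "n = 0" | "n = 1" | k where "n = Suc (Suc k)"
    by (metis One_nat_def not0_implies_Suc)
  then show ?case
  proof cases
    case (3 k)
    show ?thesis unfolding 3 S_coeff.simps(3)
      by (intro arg_cong2[where f="(*)"] arg_cong2[where f="(+)"] sum.cong refl assms less) (use 3 in auto)
  qed auto
qed

lemma S_coeff_measurable:
  assumes [measurable]: "\<And>n. A n \<in> borel_measurable M" "\<And>n. B n \<in> borel_measurable M"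
  shows "S_coeff A B c0 c1 n \<in> borel_measurable M"
proof (induction n rule: less_induct)
  case (less n)
  consider "n = 0" | "n = 1" | k where "n = Suc (Suc k)"
    by (metis One_nat_def not0_implies_Suc)
  then show ?case
  proof cases
    case 1 then show ?thesis by (simp cong: measurable_cong)
  next
    case 2 then show ?thesis by (simp cong: measurable_cong)
  next
    case (3 k)
    have [measurable]: "S_coeff A B c0 c1 m \<in> borel_measurable M" if "m \<le> Suc k" for m
      using that 3 by (intro less) auto
    have "(\<lambda>\<omega>. S_coeff A B c0 c1 n \<omega>) \<in> borel_measurable M" unfolding 3 S_coeff.simps(3)
      by (intro borel_measurable_times borel_measurable_sum borel_measurable_add borel_measurable_const assms less)
         (use 3 in auto)
    then show ?thesis by simp
  qed
qed

text \<open>The recurrence says that the coefficients of the left-hand side, computed with Cauchy products,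
vanish.\<close>

lemma power_series_solves_ODE:
  fixes q x :: real
  assumes A: "\<And>n. \<bar>A n \<omega>\<bar> * q ^ n \<le> K" and B: "\<And>n. \<bar>B n \<omega>\<bar> * q ^ n \<le> K"
    and S: "\<And>n. \<bar>S_coeff A B c0 c1 n \<omega>\<bar> * q ^ n \<le> C" and x: "\<bar>x\<bar> < q"
  defines "s \<equiv> \<lambda>n. S_coeff A B c0 c1 n \<omega>"
  shows "(\<Sum>n. diffs (diffs s) n * x ^ n) + (\<Sum>n. A n \<omega> * x ^ n) * (\<Sum>n. diffs s n * x ^ n)
            + (\<Sum>n. B n \<omega> * x ^ n) * (\<Sum>n. s n * x ^ n) = 0"
proof -
  have q: "0 < q" using x by linarith
  define p where "p = (\<bar>x\<bar> + q) / 2"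
  have p: "0 < p" "p < q" "\<bar>x\<bar> < p" using x by (auto simp: p_def)
  have sb: "\<bar>s n\<bar> * q ^ n \<le> C" for n using S by (simp add: s_def)
  note sA = geometric_bound_summable(1)[OF A q x]
  note sB = geometric_bound_summable(1)[OF B q x]
  note sS = geometric_bound_summable(1)[OF sb q x]
  have d: "\<bar>diffs s n\<bar> * p ^ n \<le> C / (q - p)" for n using diffs_geometric_bound[OF sb p(1,2)] .
  note sD = geometric_bound_summable(1)[OF d p(1,3)]
  have AD: "(\<lambda>k. \<Sum>i\<le>k. (diffs s i * x ^ i) * (A (k - i) \<omega> * x ^ (k - i))) sums
      ((\<Sum>n. diffs s n * x ^ n) * (\<Sum>n. A n \<omega> * x ^ n))" by (rule Cauchy_product_sums[OF sD sA])
  have BS: "(\<lambda>k. \<Sum>i\<le>k. (s i * x ^ i) * (B (k - i) \<omega> * x ^ (k - i))) sums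
      ((\<Sum>n. s n * x ^ n) * (\<Sum>n. B n \<omega> * x ^ n))" by (rule Cauchy_product_sums[OF sS sB])
  have eq: "diffs (diffs s) k * x ^ k = - ((\<Sum>i\<le>k. (diffs s i * x ^ i) * (A (k - i) \<omega> * x ^ (k - i)))
       + (\<Sum>i\<le>k. (s i * x ^ i) * (B (k - i) \<omega> * x ^ (k - i))))" for k
  proof -
    let ?F = "\<lambda>m. real (m + 1) * A (k - m) \<omega> * s (m + 1) + B (k - m) \<omega> * s m"
    have "diffs (diffs s) k = real (k + 2) * real (k + 1) * s (Suc (Suc k))"
      by (simp add: diffs_def mult_ac)
    also have "\<dots> = - (\<Sum>m=0..k. ?F m)" 
    proof -
      have "a * (- 1 / a * F) = - F" if "a \<noteq> 0" for a F :: real using that by simp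
      from this[of "real (k + 2) * real (k + 1)"] show ?thesis
        unfolding s_def S_coeff.simps(3) by simp
    qed
    finally have "diffs (diffs s) k * x ^ k = - (\<Sum>m\<le>k. ?F m * x ^ k)"
      by (simp add: sum_distrib_right atLeast0AtMost)
    also have "(\<Sum>m\<le>k. ?F m * x ^ k) = (\<Sum>i\<le>k. (diffs s i * x ^ i) * (A (k - i) \<omega> * x ^ (k - i)) + (s i * x ^ i) * (B (k - i) \<omega> * x ^ (k - i)))"
    proof (rule sum.cong[OF refl])
      fix i assume "i \<in> {..k}"
      then have "x ^ k = x ^ i * x ^ (k - i)" by (simp flip: power_add)
      then show "?F i * x ^ k = (diffs s i * x ^ i) * (A (k - i) \<omega> * x ^ (k - i)) + (s i * x ^ i) * (B (k - i) \<omega> * x ^ (k - i))"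
        by (simp add: diffs_def algebra_simps)
    qed
    finally show ?thesis by (simp add: sum.distrib)
  qed
  have "(\<lambda>k. diffs (diffs s) k * x ^ k) sums - ((\<Sum>n. diffs s n * x ^ n) * (\<Sum>n. A n \<omega> * x ^ n)
     + (\<Sum>n. s n * x ^ n) * (\<Sum>n. B n \<omega> * x ^ n))"
    unfolding eq by (intro sums_minus sums_add AD BS)
  then show ?thesis by (simp add: sums_iff mult.commute)
qed

section \<open>Mean square calculus\<close>

lemma L2_space_iff:
  "f \<in> L2_space M \<longleftrightarrow> f \<in> borel_measurable M \<and> integrable M (\<lambda>\<omega>. (f \<omega>)\<^sup>2)"
  by (simp add: L2_space_def)

lemma L2_space_measurable: "f \<in> L2_space M \<Longrightarrow> f \<in> borel_measurable M"
  by (simp add: L2_space_iff)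

lemma L2_norm_nonneg: "0 \<le> L2_norm M f"
  by (simp add: L2_norm_def)

lemma L2_norm_power2: "(L2_norm M f)\<^sup>2 = (\<integral>\<omega>. (f \<omega>)\<^sup>2 \<partial>M)"
  by (simp add: L2_norm_def)

lemma L2_dominated:
  assumes f: "f \<in> borel_measurable M" and g: "g \<in> L2_space M"
    and le: "AE \<omega> in M. \<bar>f \<omega>\<bar> \<le> k * g \<omega>" and k: "0 \<le> k"
  shows "f \<in> L2_space M" and "L2_norm M f \<le> k * L2_norm M g"
proof -
  have ig: "integrable M (\<lambda>\<omega>. k\<^sup>2 * (g \<omega>)\<^sup>2)" using g by (auto simp: L2_space_iff)
  have le2: "AE \<omega> in M. (f \<omega>)\<^sup>2 \<le> k\<^sup>2 * (g \<omega>)\<^sup>2"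
    using le
  proof eventually_elim
    case (elim \<omega>)
    then have "\<bar>f \<omega>\<bar>\<^sup>2 \<le> (k * g \<omega>)\<^sup>2" by (intro power_mono) auto
    then show ?case by (simp add: power_mult_distrib)
  qed
  have int: "integrable M (\<lambda>\<omega>. (f \<omega>)\<^sup>2)"
    by (rule Bochner_Integration.integrable_bound[OF ig]) (use f le2 in auto)
  then show "f \<in> L2_space M" using f by (simp add: L2_space_iff)
  have "(\<integral>\<omega>. (f \<omega>)\<^sup>2 \<partial>M) \<le> (\<integral>\<omega>. k\<^sup>2 * (g \<omega>)\<^sup>2 \<partial>M)"
    by (rule integral_mono_AE[OF int ig le2])
  then have "L2_norm M f \<le> sqrt (k\<^sup>2 * (\<integral>\<omega>. (g \<omega>)\<^sup>2 \<partial>M))"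
    by (simp add: L2_norm_def)
  then show "L2_norm M f \<le> k * L2_norm M g" using k by (simp add: L2_norm_def real_sqrt_mult)
qed

lemma L2_mult_integrable:
  assumes "f \<in> L2_space M" "g \<in> L2_space M"
  shows "integrable M (\<lambda>\<omega>. f \<omega> * g \<omega>)"
proof (rule Bochner_Integration.integrable_bound)
  show "integrable M (\<lambda>\<omega>. (f \<omega>)\<^sup>2 + (g \<omega>)\<^sup>2)" using assms by (auto simp: L2_space_iff)
  show "(\<lambda>\<omega>. f \<omega> * g \<omega>) \<in> borel_measurable M" using assms by (auto simp: L2_space_iff)
  have "\<bar>x * y\<bar> \<le> x\<^sup>2 + y\<^sup>2" for x y :: real
    using sum_squares_bound[of "\<bar>x\<bar>" "\<bar>y\<bar>"] mult_nonneg_nonneg[of "\<bar>x\<bar>" "\<bar>y\<bar>"]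
    unfolding abs_mult power2_abs mult.assoc by linarith
  then show "AE \<omega> in M. norm (f \<omega> * g \<omega>) \<le> norm ((f \<omega>)\<^sup>2 + (g \<omega>)\<^sup>2)" by auto
qed

lemma L2_lincomb:
  fixes a b :: real
  assumes f: "f \<in> L2_space M" and g: "g \<in> L2_space M"
  shows "(\<lambda>\<omega>. a * f \<omega> + b * g \<omega>) \<in> L2_space M"
proof -
  have eq: "(a * f \<omega> + b * g \<omega>)\<^sup>2 = a\<^sup>2 * (f \<omega>)\<^sup>2 + (2 * a * b) * (f \<omega> * g \<omega>) + b\<^sup>2 * (g \<omega>)\<^sup>2" for \<omega>
    by (simp add: power2_sum power_mult_distrib)
  have "integrable M (\<lambda>\<omega>. a\<^sup>2 * (f \<omega>)\<^sup>2 + (2 * a * b) * (f \<omega> * g \<omega>) + b\<^sup>2 * (g \<omega>)\<^sup>2)"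
    using f g L2_mult_integrable[OF f g] by (intro Bochner_Integration.integrable_add integrable_mult_right) (auto simp: L2_space_iff)
  moreover have "(\<lambda>\<omega>. a * f \<omega> + b * g \<omega>) \<in> borel_measurable M"
    using f g by (auto simp: L2_space_iff)
  ultimately show ?thesis unfolding L2_space_iff eq by simp
qed

lemma L2_diff: "f \<in> L2_space M \<Longrightarrow> g \<in> L2_space M \<Longrightarrow> (\<lambda>\<omega>. f \<omega> - g \<omega>) \<in> L2_space M"
  using L2_lincomb[of f M g 1 "-1"] by simp

lemma L2_difference_quotient:
  "f \<in> L2_space M \<Longrightarrow> g \<in> L2_space M \<Longrightarrow> d \<in> L2_space M \<Longrightarrow> (\<lambda>\<omega>. (f \<omega> - g \<omega>) / h - d \<omega>) \<in> L2_space M"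
  using L2_lincomb[of "\<lambda>\<omega>. f \<omega> - g \<omega>" M d "1 / h" "-1"] L2_diff[of f M g] by simp

lemma L2_Cauchy_Schwarz:
  assumes f: "f \<in> L2_space M" and g: "g \<in> L2_space M"
  shows "\<bar>\<integral>\<omega>. f \<omega> * g \<omega> \<partial>M\<bar> \<le> L2_norm M f * L2_norm M g"
proof -
  define a b c where "a = (\<integral>\<omega>. (f \<omega>)\<^sup>2 \<partial>M)" and "b = (\<integral>\<omega>. f \<omega> * g \<omega> \<partial>M)" and "c = (\<integral>\<omega>. (g \<omega>)\<^sup>2 \<partial>M)"
  have if2: "integrable M (\<lambda>\<omega>. (f \<omega>)\<^sup>2)" and ig2: "integrable M (\<lambda>\<omega>. (g \<omega>)\<^sup>2)"
    using f g by (auto simp: L2_space_iff)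
  note ifg = L2_mult_integrable[OF f g]
  have "b\<^sup>2 \<le> a * c"
  proof (cases "a = 0")
    case True
    then have "AE \<omega> in M. (f \<omega>)\<^sup>2 = 0"
      unfolding a_def by (subst (asm) integral_nonneg_eq_0_iff_AE[OF if2]) auto
    then have "AE \<omega> in M. f \<omega> * g \<omega> = 0" by eventually_elim simp
    then have "b = 0" unfolding b_def by (rule integral_eq_zero_AE)
    then show ?thesis using True by simp
  next
    case False
    then have a: "0 < a" unfolding a_def by (simp add: order_less_le)
    \<comment> \<open>The quadratic polynomial \<open>s \<mapsto> E (s f + g)\<^sup>2\<close> is evaluated at its minimum.\<close>
    define s where "s = - b / a"
    have "0 \<le> (\<integral>\<omega>. (s * f \<omega> + g \<omega>)\<^sup>2 \<partial>M)" by simp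
    also have "\<dots> = (\<integral>\<omega>. s\<^sup>2 * (f \<omega>)\<^sup>2 + (2 * s) * (f \<omega> * g \<omega>) + (g \<omega>)\<^sup>2 \<partial>M)"
      by (simp add: power2_sum power_mult_distrib algebra_simps)
    also have "\<dots> = s\<^sup>2 * a + 2 * s * b + c"
      using if2 ig2 ifg by (simp add: a_def b_def c_def)
    also have "\<dots> = c - b\<^sup>2 / a" using a by (simp add: s_def power2_eq_square field_simps)
    finally show ?thesis using a by (simp add: field_simps)
  qed
  then have "sqrt (b\<^sup>2) \<le> sqrt (a * c)" by (rule real_sqrt_le_mono)
  then show ?thesis by (simp add: L2_norm_def real_sqrt_mult a_def b_def c_def)
qed

lemma L2_norm_diff_le:
  assumes f: "f \<in> L2_space M" and g: "g \<in> L2_space M"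
  shows "L2_norm M (\<lambda>\<omega>. f \<omega> - g \<omega>) \<le> L2_norm M f + L2_norm M g"
proof (rule power2_le_imp_le)
  have if2: "integrable M (\<lambda>\<omega>. (f \<omega>)\<^sup>2)" and ig2: "integrable M (\<lambda>\<omega>. (g \<omega>)\<^sup>2)"
    using f g by (auto simp: L2_space_iff)
  note ifg = L2_mult_integrable[OF f g]
  have "(L2_norm M (\<lambda>\<omega>. f \<omega> - g \<omega>))\<^sup>2 = (\<integral>\<omega>. (f \<omega>)\<^sup>2 + (g \<omega>)\<^sup>2 - 2 * (f \<omega> * g \<omega>) \<partial>M)"
    unfolding L2_norm_power2 by (simp add: power2_diff mult_ac)
  also have "\<dots> = (L2_norm M f)\<^sup>2 + (L2_norm M g)\<^sup>2 - 2 * (\<integral>\<omega>. f \<omega> * g \<omega> \<partial>M)"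
    using if2 ig2 ifg by (simp add: L2_norm_power2)
  also have "\<dots> \<le> (L2_norm M f + L2_norm M g)\<^sup>2"
    using L2_Cauchy_Schwarz[OF f g] by (simp add: power2_sum)
  finally show "(L2_norm M (\<lambda>\<omega>. f \<omega> - g \<omega>))\<^sup>2 \<le> (L2_norm M f + L2_norm M g)\<^sup>2" .
qed (simp add: L2_norm_nonneg)

lemma has_ms_derivativeD:
  assumes "has_ms_derivative M X D t"
  shows "D \<in> L2_space M" "X t \<in> L2_space M" "\<forall>\<^sub>F h in at 0. X (t + h) \<in> L2_space M"
    "((\<lambda>h. L2_norm M (\<lambda>\<omega>. (X (t + h) \<omega> - X t \<omega>) / h - D \<omega>)) \<longlongrightarrow> 0) (at 0)"
proof -
  have ev: "\<forall>\<^sub>F s in nhds t. X s \<in> L2_space M" using assms by (simp add: has_ms_derivative_def)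
  then show "X t \<in> L2_space M" by (rule eventually_nhds_x_imp_x)
  have "((\<lambda>h. t + h) \<longlongrightarrow> t + 0) (at 0)" by (intro tendsto_intros)
  then show "\<forall>\<^sub>F h in at 0. X (t + h) \<in> L2_space M"
    using ev unfolding filterlim_iff by fastforce
qed (use assms in \<open>auto simp: has_ms_derivative_def\<close>)

lemma has_ms_derivative_diff:
  assumes X: "has_ms_derivative M X D t" and Y: "has_ms_derivative M Y E t"
  shows "has_ms_derivative M (\<lambda>s \<omega>. X s \<omega> - Y s \<omega>) (\<lambda>\<omega>. D \<omega> - E \<omega>) t"
  unfolding has_ms_derivative_def
proof (intro conjI)
  note x = has_ms_derivativeD[OF X] and y = has_ms_derivativeD[OF Y]
  show "(\<lambda>\<omega>. D \<omega> - E \<omega>) \<in> L2_space M" using x y by (intro L2_diff)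
  have "\<forall>\<^sub>F s in nhds t. X s \<in> L2_space M" "\<forall>\<^sub>F s in nhds t. Y s \<in> L2_space M"
    using X Y by (auto simp: has_ms_derivative_def)
  then show "\<forall>\<^sub>F s in nhds t. (\<lambda>\<omega>. X s \<omega> - Y s \<omega>) \<in> L2_space M"
    by eventually_elim (rule L2_diff)
  let ?q = "\<lambda>X D h \<omega>. (X (t + h) \<omega> - X t \<omega>) / h - D \<omega> :: real"
  show "((\<lambda>h. L2_norm M (\<lambda>\<omega>. (X (t + h) \<omega> - Y (t + h) \<omega> - (X t \<omega> - Y t \<omega>)) / h - (D \<omega> - E \<omega>))) \<longlongrightarrow> 0) (at 0)"
  proof (rule Lim_null_comparison)
    show "((\<lambda>h. L2_norm M (?q X D h) + L2_norm M (?q Y E h)) \<longlongrightarrow> 0) (at 0)"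
      using tendsto_add[OF x(4) y(4)] by simp
    show "\<forall>\<^sub>F h in at 0. norm (L2_norm M (\<lambda>\<omega>. (X (t + h) \<omega> - Y (t + h) \<omega> - (X t \<omega> - Y t \<omega>)) / h - (D \<omega> - E \<omega>)))
         \<le> L2_norm M (?q X D h) + L2_norm M (?q Y E h)"
      using x(3) y(3)
    proof eventually_elim
      case (elim h)
      have "(\<lambda>\<omega>. (X (t + h) \<omega> - Y (t + h) \<omega> - (X t \<omega> - Y t \<omega>)) / h - (D \<omega> - E \<omega>)) = (\<lambda>\<omega>. ?q X D h \<omega> - ?q Y E h \<omega>)"
        by (rule ext) (simp add: diff_divide_distrib)
      then show ?case
        using L2_norm_diff_le[OF L2_difference_quotient[OF elim(1) x(2,1), of h] L2_difference_quotient[OF elim(2) y(2,1), of h]]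
        by (simp add: L2_norm_nonneg)
    qed
  qed
qed

text \<open>With \<open>V = (Z (t + h) - Z t) / h\<close>, which is close to \<open>D\<close> in \<open>L\<^sup>2\<close>, the square \<open>(Z t + h V)\<^sup>2\<close> is expanded
and the error is bounded by the Cauchy-Schwarz inequality. This reduces questions about mean square
derivatives to questions about real functions.\<close>

lemma DERIV_second_moment:
  assumes Z: "has_ms_derivative M Z D t"
  shows "((\<lambda>s. \<integral>\<omega>. (Z s \<omega>)\<^sup>2 \<partial>M) has_field_derivative 2 * (\<integral>\<omega>. Z t \<omega> * D \<omega> \<partial>M)) (at t)"
proof -
  note z = has_ms_derivativeD[OF Z]
  define R where "R = (\<lambda>h \<omega>. (Z (t + h) \<omega> - Z t \<omega>) / h - D \<omega>)"
  define r where "r = (\<lambda>h. L2_norm M (R h))"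
  have r: "(r \<longlongrightarrow> 0) (at 0)" using z(4) by (simp add: r_def R_def)
  let ?\<phi> = "\<lambda>s. \<integral>\<omega>. (Z s \<omega>)\<^sup>2 \<partial>M"
  let ?d = "2 * (\<integral>\<omega>. Z t \<omega> * D \<omega> \<partial>M)"
  have "((\<lambda>h. (?\<phi> (t + h) - ?\<phi> t) / h - ?d) \<longlongrightarrow> 0) (at 0)"
  proof (rule Lim_null_comparison)
    have "((\<lambda>h. 2 * (L2_norm M (Z t) * r h) + \<bar>h\<bar> * (r h + L2_norm M D)\<^sup>2) \<longlongrightarrow>
        2 * (L2_norm M (Z t) * 0) + \<bar>0\<bar> * (0 + L2_norm M D)\<^sup>2) (at 0)"
      by (intro tendsto_intros r)
    then show "((\<lambda>h. 2 * (L2_norm M (Z t) * r h) + \<bar>h\<bar> * (r h + L2_norm M D)\<^sup>2) \<longlongrightarrow> 0) (at 0)" by simp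
    have h0: "\<forall>\<^sub>F h in at (0::real). h \<noteq> 0" by (simp add: eventually_at_filter)
    show "\<forall>\<^sub>F h in at 0. norm ((?\<phi> (t + h) - ?\<phi> t) / h - ?d) \<le> 2 * (L2_norm M (Z t) * r h) + \<bar>h\<bar> * (r h + L2_norm M D)\<^sup>2"
      using z(3) h0
    proof eventually_elim
      case (elim h)
      have R: "R h \<in> L2_space M" unfolding R_def by (intro L2_difference_quotient elim z)
      have mD: "(\<lambda>\<omega>. - D \<omega>) \<in> L2_space M" using z(1) by (auto simp: L2_space_iff)
      define V where "V = (\<lambda>\<omega>. R h \<omega> - (- D \<omega>))"
      have V: "V \<in> L2_space M" unfolding V_def by (intro L2_diff R mD)
      have "L2_norm M V \<le> r h + L2_norm M D"
        unfolding V_def using L2_norm_diff_le[OF R mD] by (simp add: r_def L2_norm_def)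
      then have nV: "(L2_norm M V)\<^sup>2 \<le> (r h + L2_norm M D)\<^sup>2" by (intro power_mono L2_norm_nonneg)
      have Zh: "Z (t + h) \<omega> = Z t \<omega> + h * V \<omega>" for \<omega>
        using elim(2) by (simp add: V_def R_def)
      have "?\<phi> (t + h) = (\<integral>\<omega>. (Z t \<omega>)\<^sup>2 + (2 * h) * (Z t \<omega> * V \<omega>) + h\<^sup>2 * (V \<omega>)\<^sup>2 \<partial>M)"
        unfolding Zh by (simp add: power2_sum power_mult_distrib algebra_simps)
      also have "\<dots> = ?\<phi> t + 2 * h * (\<integral>\<omega>. Z t \<omega> * V \<omega> \<partial>M) + h\<^sup>2 * (L2_norm M V)\<^sup>2"
        using z(2) V L2_mult_integrable[OF z(2) V] by (simp add: L2_space_iff L2_norm_power2)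
      also have "(\<integral>\<omega>. Z t \<omega> * V \<omega> \<partial>M) = (\<integral>\<omega>. Z t \<omega> * R h \<omega> + Z t \<omega> * D \<omega> \<partial>M)"
        by (simp add: V_def algebra_simps)
      also have "\<dots> = (\<integral>\<omega>. Z t \<omega> * R h \<omega> \<partial>M) + (\<integral>\<omega>. Z t \<omega> * D \<omega> \<partial>M)"
        by (intro Bochner_Integration.integral_add L2_mult_integrable z R)
      finally have "(?\<phi> (t + h) - ?\<phi> t) / h - ?d = 2 * (\<integral>\<omega>. Z t \<omega> * R h \<omega> \<partial>M) + h * (L2_norm M V)\<^sup>2"
        using elim(2) by (simp add: field_simps power2_eq_square)
      moreover have "\<bar>\<integral>\<omega>. Z t \<omega> * R h \<omega> \<partial>M\<bar> \<le> L2_norm M (Z t) * r h"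
        unfolding r_def by (rule L2_Cauchy_Schwarz[OF z(2) R])
      moreover have "\<bar>h * (L2_norm M V)\<^sup>2\<bar> \<le> \<bar>h\<bar> * (r h + L2_norm M D)\<^sup>2"
        unfolding abs_mult using nV by (intro mult_left_mono) auto
      ultimately show ?case by (simp only: real_norm_def)
    qed
  qed
  then show ?thesis unfolding DERIV_def by (simp add: LIM_zero_iff)
qed

section \<open>Uniqueness of mean square solutions\<close>

text \<open>On the right of \<open>t0\<close> the function \<open>u s exp (- C s)\<close> is nonincreasing, on the left of \<open>t0\<close> the function
\<open>u s exp (C s)\<close> is nondecreasing; both vanish at \<open>t0\<close>.\<close>

lemma Gronwall_zero:
  fixes u :: "real \<Rightarrow> real"
  assumes der: "\<And>s. \<bar>s - t0\<bar> \<le> \<bar>t - t0\<bar> \<Longrightarrow> (u has_field_derivative u' s) (at s)"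
    and le: "\<And>s. \<bar>s - t0\<bar> \<le> \<bar>t - t0\<bar> \<Longrightarrow> \<bar>u' s\<bar> \<le> C * u s"
    and u0: "u t0 = 0" and nonneg: "0 \<le> u t"
  shows "u t = 0"
proof (cases "t0 \<le> t")
  case True
  have "u t * exp (- C * t) \<le> u t0 * exp (- C * t0)"
  proof (rule DERIV_nonpos_imp_nonincreasing[OF True])
    fix s assume s: "t0 \<le> s" "s \<le> t"
    then have s': "\<bar>s - t0\<bar> \<le> \<bar>t - t0\<bar>" by simp
    have "((\<lambda>s. u s * exp (- C * s)) has_field_derivative (u' s - C * u s) * exp (- C * s)) (at s)"
      by (rule derivative_eq_intros der[OF s'] refl)+ (simp add: algebra_simps)
    moreover have "(u' s - C * u s) * exp (- C * s) \<le> 0"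
      using le[OF s'] by (intro mult_nonpos_nonneg) auto
    ultimately show "\<exists>y. ((\<lambda>s. u s * exp (- C * s)) has_field_derivative y) (at s) \<and> y \<le> 0" by blast
  qed
  then have "u t \<le> 0" using u0 by (simp add: mult_le_0_iff)
  then show ?thesis using nonneg by simp
next
  case False
  then have le': "t \<le> t0" by simp
  have "u t * exp (C * t) \<le> u t0 * exp (C * t0)"
  proof (rule DERIV_nonneg_imp_nondecreasing[OF le'])
    fix s assume s: "t \<le> s" "s \<le> t0"
    then have s': "\<bar>s - t0\<bar> \<le> \<bar>t - t0\<bar>" by simp
    have "((\<lambda>s. u s * exp (C * s)) has_field_derivative (u' s + C * u s) * exp (C * s)) (at s)"
      by (rule derivative_eq_intros der[OF s'] refl)+ (simp add: algebra_simps)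
    moreover have "0 \<le> (u' s + C * u s) * exp (C * s)"
      using le[OF s'] by (intro mult_nonneg_nonneg) auto
    ultimately show "\<exists>y. ((\<lambda>s. u s * exp (C * s)) has_field_derivative y) (at s) \<and> 0 \<le> y" by blast
  qed
  then have "u t \<le> 0" using u0 by (simp add: mult_le_0_iff)
  then show ?thesis using nonneg by simp
qed

text \<open>The energy \<open>u = E Z\<^sup>2 + E Z'\<^sup>2\<close> is a real function with \<open>u' = 2 E (Z Z') + 2 E (Z' Z'')\<close>. Inserting
the equation for \<open>Z''\<close> and using that the coefficients are bounded gives \<open>\<bar>u'\<bar> \<le> C u\<close>.\<close>

lemma ms_linear_ODE_zero:
  fixes a b :: "real \<Rightarrow> 'a \<Rightarrow> real" and t0 t K :: real
  defines "J \<equiv> {s. \<bar>s - t0\<bar> \<le> \<bar>t - t0\<bar>}"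
  assumes Z: "\<And>s. s \<in> J \<Longrightarrow> has_ms_derivative M Z (Z' s) s"
    and Z': "\<And>s. s \<in> J \<Longrightarrow> has_ms_derivative M Z' (Z'' s) s"
    and ode: "\<And>s. s \<in> J \<Longrightarrow> AE \<omega> in M. Z'' s \<omega> + a s \<omega> * Z' s \<omega> + b s \<omega> * Z s \<omega> = 0"
    and a: "\<And>s. s \<in> J \<Longrightarrow> AE \<omega> in M. \<bar>a s \<omega>\<bar> \<le> K" and b: "\<And>s. s \<in> J \<Longrightarrow> AE \<omega> in M. \<bar>b s \<omega>\<bar> \<le> K"
    and init: "AE \<omega> in M. Z t0 \<omega> = 0" "AE \<omega> in M. Z' t0 \<omega> = 0"
  shows "AE \<omega> in M. Z t \<omega> = 0"
proof -
  define u where "u = (\<lambda>s. (\<integral>\<omega>. (Z s \<omega>)\<^sup>2 \<partial>M) + (\<integral>\<omega>. (Z' s \<omega>)\<^sup>2 \<partial>M))"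
  define u' where "u' = (\<lambda>s. 2 * (\<integral>\<omega>. Z s \<omega> * Z' s \<omega> \<partial>M) + 2 * (\<integral>\<omega>. Z' s \<omega> * Z'' s \<omega> \<partial>M))"
  define C where "C = 1 + 3 * \<bar>K\<bar>"
  have tJ: "t \<in> J" by (simp add: J_def)
  have "u t = 0"
  proof (rule Gronwall_zero[where u = u and t = t and u' = u' and C = C and ?t0.0 = t0])
    fix s assume "\<bar>s - t0\<bar> \<le> \<bar>t - t0\<bar>"
    then have s: "s \<in> J" by (simp add: J_def)
    show "(u has_field_derivative u' s) (at s)"
      unfolding u_def u'_def by (intro DERIV_add DERIV_second_moment Z Z' s)
    note z = has_ms_derivativeD(1,2)[OF Z[OF s]] has_ms_derivativeD(1)[OF Z'[OF s]]
    note i = L2_mult_integrable[OF z(2,1)] L2_mult_integrable[OF z(1,3)]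
    have i2: "integrable M (\<lambda>\<omega>. (Z s \<omega>)\<^sup>2)" "integrable M (\<lambda>\<omega>. (Z' s \<omega>)\<^sup>2)"
      using z by (auto simp: L2_space_iff)
    have pt: "AE \<omega> in M. \<bar>2 * (Z s \<omega> * Z' s \<omega>) + 2 * (Z' s \<omega> * Z'' s \<omega>)\<bar> \<le> C * ((Z s \<omega>)\<^sup>2 + (Z' s \<omega>)\<^sup>2)"
      using ode[OF s] a[OF s] b[OF s]
    proof eventually_elim
      case (elim \<omega>)
      define x y where "x = Z s \<omega>" and "y = Z' s \<omega>"
      have w: "Z'' s \<omega> = - a s \<omega> * y - b s \<omega> * x" using elim(1) by (simp add: x_def y_def)
      have xy: "2 * \<bar>x * y\<bar> \<le> x\<^sup>2 + y\<^sup>2"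
        using sum_squares_bound[of "\<bar>x\<bar>" "\<bar>y\<bar>"] by (simp add: abs_mult)
      have "2 * (x * y) + 2 * (y * Z'' s \<omega>) = 2 * (x * y) - 2 * (a s \<omega> * y\<^sup>2) - b s \<omega> * (2 * (x * y))"
        unfolding w by (simp add: algebra_simps power2_eq_square)
      also have "\<bar>\<dots>\<bar> \<le> 2 * \<bar>x * y\<bar> + 2 * (\<bar>a s \<omega>\<bar> * y\<^sup>2) + \<bar>b s \<omega>\<bar> * (2 * \<bar>x * y\<bar>)"
      proof -
        have "\<bar>p - q - r\<bar> \<le> \<bar>p\<bar> + \<bar>q\<bar> + \<bar>r\<bar>" for p q r :: real by linarith
        from this[of "2 * (x * y)" "2 * (a s \<omega> * y\<^sup>2)" "b s \<omega> * (2 * (x * y))"]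
        show ?thesis by (simp add: abs_mult)
      qed
      also have "\<dots> \<le> (x\<^sup>2 + y\<^sup>2) + 2 * (\<bar>K\<bar> * (x\<^sup>2 + y\<^sup>2)) + \<bar>K\<bar> * (x\<^sup>2 + y\<^sup>2)"
        using elim xy by (intro add_mono mult_left_mono mult_mono) auto
      also have "\<dots> = C * (x\<^sup>2 + y\<^sup>2)" by (simp add: C_def algebra_simps)
      finally show ?case by (simp add: x_def y_def)
    qed
    have "u' s = (\<integral>\<omega>. 2 * (Z s \<omega> * Z' s \<omega>) + 2 * (Z' s \<omega> * Z'' s \<omega>) \<partial>M)"
      unfolding u'_def using i by simp
    also have "\<bar>\<dots>\<bar> \<le> (\<integral>\<omega>. \<bar>2 * (Z s \<omega> * Z' s \<omega>) + 2 * (Z' s \<omega> * Z'' s \<omega>)\<bar> \<partial>M)"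
      by (rule integral_abs_bound)
    also have "\<dots> \<le> (\<integral>\<omega>. C * ((Z s \<omega>)\<^sup>2 + (Z' s \<omega>)\<^sup>2) \<partial>M)"
      by (rule integral_mono_AE[OF _ _ pt]) (use i i2 in auto)
    also have "\<dots> = C * u s" unfolding u_def using i2 by simp
    finally show "\<bar>u' s\<bar> \<le> C * u s" .
  next
    have "(\<integral>\<omega>. (Z t0 \<omega>)\<^sup>2 \<partial>M) = 0" using init(1) by (intro integral_eq_zero_AE) (auto elim: eventually_mono)
    moreover have "(\<integral>\<omega>. (Z' t0 \<omega>)\<^sup>2 \<partial>M) = 0" using init(2) by (intro integral_eq_zero_AE) (auto elim: eventually_mono)
    ultimately show "u t0 = 0" by (simp add: u_def)
  qed (simp add: u_def)
  then have "(\<integral>\<omega>. (Z t \<omega>)\<^sup>2 \<partial>M) = 0" unfolding u_def by (simp add: add_nonneg_eq_0_iff)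
  moreover have "integrable M (\<lambda>\<omega>. (Z t \<omega>)\<^sup>2)"
    using has_ms_derivativeD(2)[OF Z[OF tJ]] by (simp add: L2_space_iff)
  ultimately have "AE \<omega> in M. (Z t \<omega>)\<^sup>2 = 0"
    by (subst (asm) integral_nonneg_eq_0_iff_AE) auto
  then show ?thesis by eventually_elim simp
qed

text \<open>The second order remainder is at most \<open>L G(\<omega>) h\<^sup>2\<close>, so the difference quotient of the random series
differs from its termwise derivative by at most \<open>L \<bar>h\<bar> \<parallel>G\<parallel>\<close> in \<open>L\<^sup>2\<close>.\<close>

lemma power_series_has_ms_derivative:
  fixes c :: "nat \<Rightarrow> 'a \<Rightarrow> real"
  assumes c[measurable]: "\<And>n. c n \<in> borel_measurable M" and G: "G \<in> L2_space M"
    and bound: "AE \<omega> in M. \<forall>n. \<bar>c n \<omega>\<bar> * q ^ n \<le> G \<omega>" and t: "\<bar>t - t0\<bar> < q"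
  shows "has_ms_derivative M (\<lambda>s \<omega>. \<Sum>n. c n \<omega> * (s - t0) ^ n)
           (\<lambda>\<omega>. \<Sum>n. diffs (\<lambda>n. c n \<omega>) n * (t - t0) ^ n) t"
proof -
  have q: "0 < q" using t by linarith
  define p where "p = (\<bar>t - t0\<bar> + q) / 2"
  have p: "0 < p" "p < q" "\<bar>t - t0\<bar> < p" using t by (auto simp: p_def)
  obtain L where L: "0 \<le> L"
    "\<And>c C x h. (\<And>n. \<bar>c n\<bar> * q ^ n \<le> C) \<Longrightarrow> \<bar>x\<bar> \<le> p \<Longrightarrow> \<bar>x + h\<bar> \<le> p \<Longrightarrow>
       \<bar>(\<Sum>n. c n * (x + h) ^ n) - (\<Sum>n. c n * x ^ n) - h * (\<Sum>n. diffs c n * x ^ n)\<bar> \<le> L * C * h\<^sup>2"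
    using power_series_second_order_remainder[OF p(1,2)] by blast
  let ?Y = "\<lambda>s \<omega>. \<Sum>n. c n \<omega> * (s - t0) ^ n"
  let ?D = "\<lambda>\<omega>. \<Sum>n. diffs (\<lambda>n. c n \<omega>) n * (t - t0) ^ n"
  have mY[measurable]: "?Y s \<in> borel_measurable M" for s by measurable
  have mD[measurable]: "?D \<in> borel_measurable M" unfolding diffs_def by measurable
  have Y_L2: "?Y s \<in> L2_space M" if s: "\<bar>s - t0\<bar> < q" for s
  proof (rule L2_dominated(1)[OF mY G])
    show "AE \<omega> in M. \<bar>?Y s \<omega>\<bar> \<le> (1 / (1 - \<bar>s - t0\<bar> / q)) * G \<omega>"
      using bound
    proof eventually_elim
      case (elim \<omega>)
      then show ?case using geometric_bound_summable(2)[of "\<lambda>n. c n \<omega>" q "G \<omega>" "s - t0"] q s by simp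
    qed
    show "0 \<le> 1 / (1 - \<bar>s - t0\<bar> / q)" using s q by simp
  qed
  have D_L2: "?D \<in> L2_space M"
  proof (rule L2_dominated(1)[OF mD G])
    show "AE \<omega> in M. \<bar>?D \<omega>\<bar> \<le> (1 / (q - p) / (1 - \<bar>t - t0\<bar> / p)) * G \<omega>"
      using bound
    proof eventually_elim
      case (elim \<omega>)
      have d: "\<bar>diffs (\<lambda>n. c n \<omega>) n\<bar> * p ^ n \<le> G \<omega> / (q - p)" for n
        by (rule diffs_geometric_bound) (use elim p in auto)
      show ?case using geometric_bound_summable(2)[OF d p(1,3)] by simp
    qed
    show "0 \<le> 1 / (q - p) / (1 - \<bar>t - t0\<bar> / p)" using p by simp
  qed
  show ?thesis unfolding has_ms_derivative_def
  proof (intro conjI D_L2)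
    have "((\<lambda>s. \<bar>s - t0\<bar>) \<longlongrightarrow> \<bar>t - t0\<bar>) (nhds t)" by (intro tendsto_intros filterlim_ident)
    then have "\<forall>\<^sub>F s in nhds t. \<bar>s - t0\<bar> < q" using t by (rule order_tendstoD)
    then show "\<forall>\<^sub>F s in nhds t. ?Y s \<in> L2_space M" by eventually_elim (rule Y_L2)
    show "((\<lambda>h. L2_norm M (\<lambda>\<omega>. (?Y (t + h) \<omega> - ?Y t \<omega>) / h - ?D \<omega>)) \<longlongrightarrow> 0) (at 0)"
    proof (rule Lim_null_comparison)
      have "((\<lambda>h. L * \<bar>h\<bar> * L2_norm M G) \<longlongrightarrow> L * \<bar>0\<bar> * L2_norm M G) (at 0)" by (intro tendsto_intros)
      then show "((\<lambda>h. L * \<bar>h\<bar> * L2_norm M G) \<longlongrightarrow> 0) (at 0)" by simp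
      have "((\<lambda>h. \<bar>t + h - t0\<bar>) \<longlongrightarrow> \<bar>t + 0 - t0\<bar>) (at 0)" by (intro tendsto_intros)
      then have "\<forall>\<^sub>F h in at 0. \<bar>t + h - t0\<bar> < p" using p(3) by (intro order_tendstoD) auto
      moreover have "\<forall>\<^sub>F h in at (0::real). h \<noteq> 0" by (simp add: eventually_at_filter)
      ultimately show "\<forall>\<^sub>F h in at 0. norm (L2_norm M (\<lambda>\<omega>. (?Y (t + h) \<omega> - ?Y t \<omega>) / h - ?D \<omega>)) \<le> L * \<bar>h\<bar> * L2_norm M G"
      proof eventually_elim
        case (elim h)
        have "L2_norm M (\<lambda>\<omega>. (?Y (t + h) \<omega> - ?Y t \<omega>) / h - ?D \<omega>) \<le> (L * \<bar>h\<bar>) * L2_norm M G"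
        proof (rule L2_dominated(2)[OF _ G])
          show "AE \<omega> in M. \<bar>(?Y (t + h) \<omega> - ?Y t \<omega>) / h - ?D \<omega>\<bar> \<le> L * \<bar>h\<bar> * G \<omega>"
            using bound
          proof eventually_elim
            case (elim \<omega>)
            have th: "t - t0 + h = t + h - t0" by simp
            have "\<bar>?Y (t + h) \<omega> - ?Y t \<omega> - h * ?D \<omega>\<bar> \<le> L * G \<omega> * h\<^sup>2"
              using L(2)[of "\<lambda>n. c n \<omega>" "G \<omega>" "t - t0" h] elim p(3) \<open>\<bar>t + h - t0\<bar> < p\<close>
              unfolding th by simp
            then have "\<bar>?Y (t + h) \<omega> - ?Y t \<omega> - h * ?D \<omega>\<bar> / \<bar>h\<bar> \<le> L * G \<omega> * h\<^sup>2 / \<bar>h\<bar>"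
              by (intro divide_right_mono) auto
            also have "L * G \<omega> * h\<^sup>2 / \<bar>h\<bar> = L * \<bar>h\<bar> * G \<omega>"
              using \<open>h \<noteq> 0\<close> power2_abs[of h] by (simp add: field_simps power2_eq_square)
            also have "\<bar>?Y (t + h) \<omega> - ?Y t \<omega> - h * ?D \<omega>\<bar> / \<bar>h\<bar> = \<bar>(?Y (t + h) \<omega> - ?Y t \<omega>) / h - ?D \<omega>\<bar>"
              unfolding abs_divide[symmetric] using \<open>h \<noteq> 0\<close> by (simp add: diff_divide_distrib)
            finally show ?case .
          qed
          show "(\<lambda>\<omega>. (?Y (t + h) \<omega> - ?Y t \<omega>) / h - ?D \<omega>) \<in> borel_measurable M" by measurable
        qed (use L in simp)
        then show ?case by (simp add: L2_norm_nonneg)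
      qed
    qed
  qed
qed

section \<open>Series in the space of essentially bounded variables\<close>

lemma Linf_norm_le:
  assumes "f \<in> borel_measurable M" "AE \<omega> in M. \<bar>f \<omega>\<bar> \<le> k"
  shows "Linf_norm M f \<le> ereal k"
  unfolding Linf_norm_def using assms by (intro esssup_I) auto

lemma AE_le_Linf_norm: "AE \<omega> in M. ereal \<bar>f \<omega>\<bar> \<le> Linf_norm M f"
  unfolding Linf_norm_def by (rule esssup_AE)

text \<open>The total mass must be positive here: on a null space the essential supremum is \<open>- \<infinity>\<close>.\<close>

lemma (in prob_space) Linf_norm_nonneg:
  assumes "f \<in> borel_measurable M"
  shows "0 \<le> Linf_norm M f"
proof -
  have "esssup M (\<lambda>\<omega>. 0 :: ereal) \<le> Linf_norm M f"
    unfolding Linf_norm_def by (intro esssup_mono) auto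
  then show ?thesis by (simp add: esssup_const emeasure_space_1)
qed

lemma Linf_space_bounded:
  assumes "f \<in> Linf_space M"
  obtains k where "0 \<le> k" "AE \<omega> in M. \<bar>f \<omega>\<bar> \<le> k"
proof -
  obtain n :: nat where n: "Linf_norm M f < ereal (real n)"
    using assms less_PInf_Ex_of_nat[of "Linf_norm M f"] by (auto simp: Linf_space_def)
  have "AE \<omega> in M. \<bar>f \<omega>\<bar> \<le> real n"
    using AE_le_Linf_norm[of f M]
  proof eventually_elim
    case (elim \<omega>)
    then have "ereal \<bar>f \<omega>\<bar> \<le> ereal (real n)" using n by (meson order.trans less_imp_le)
    then show ?case by simp
  qed
  then show thesis using that[of "real n"] by simp
qed

lemma Linf_sums_AE_sums:
  assumes "Linf_sums M F s"
  shows "AE \<omega> in M. (\<lambda>n. F n \<omega>) sums s \<omega>"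
proof -
  define e where "e = (\<lambda>N. Linf_norm M (\<lambda>\<omega>. (\<Sum>n<N. F n \<omega>) - s \<omega>))"
  have e: "e \<longlonglongrightarrow> 0" using assms by (simp add: Linf_sums_def e_def)
  have "AE \<omega> in M. \<forall>N. ereal \<bar>(\<Sum>n<N. F n \<omega>) - s \<omega>\<bar> \<le> e N"
    unfolding e_def by (subst AE_all_countable) (intro allI AE_le_Linf_norm)
  then show ?thesis
  proof eventually_elim
    case (elim \<omega>)
    have "(\<lambda>N. ereal \<bar>(\<Sum>n<N. F n \<omega>) - s \<omega>\<bar>) \<longlonglongrightarrow> 0"
      by (rule tendsto_sandwich[OF _ _ tendsto_const e]) (use elim in auto)
    then have "(\<lambda>N. \<bar>(\<Sum>n<N. F n \<omega>) - s \<omega>\<bar>) \<longlonglongrightarrow> 0"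
      by (simp add: zero_ereal_def)
    then show ?case unfolding sums_def by (simp add: tendsto_rabs_zero_iff LIM_zero_iff)
  qed
qed

text \<open>The representative chosen for the \<open>L\<^sup>\<infinity>\<close> sum is almost surely the pointwise sum, so from here on
random power series can be treated as ordinary ones.\<close>

lemma random_power_series_AE_eq:
  assumes "\<exists>s. Linf_sums M (\<lambda>n \<omega>. C n \<omega> * (t - t0) ^ n) s"
  shows "AE \<omega> in M. random_power_series M C t0 t \<omega> = (\<Sum>n. C n \<omega> * (t - t0) ^ n)"
proof -
  have "Linf_sums M (\<lambda>n \<omega>. C n \<omega> * (t - t0) ^ n) (random_power_series M C t0 t)"
    unfolding random_power_series_def Linf_suminf_def using assms by (rule someI_ex)
  from Linf_sums_AE_sums[OF this] show ?thesis by eventually_elim (simp add: sums_iff)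
qed

text \<open>Convergence in \<open>L\<^sup>\<infinity>\<close> at the point \<open>t0 + \<rho>\<close> bounds the terms \<open>C\<^sub>n \<rho>\<^sup>n\<close> by one constant outside of one null
set: late terms are differences of two partial sums at distance at most 1 from the limit, and each of
the finitely many early terms is essentially bounded.\<close>

lemma Linf_setting_geometric_bound:
  assumes C: "Linf_setting M C t0 r" and \<rho>: "0 < \<rho>" "\<rho> < r"
  obtains K where "0 \<le> K" "AE \<omega> in M. \<forall>n. \<bar>C n \<omega>\<bar> * \<rho> ^ n \<le> K"
proof -
  define F where "F = (\<lambda>n \<omega>. C n \<omega> * \<rho> ^ n)"
  have "t0 + \<rho> \<in> {t0 - r<..<t0 + r}" using \<rho> by auto
  then obtain s where s: "Linf_sums M F s"
    using C unfolding Linf_setting_def F_def by fastforce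
  define P where "P = (\<lambda>N \<omega>. (\<Sum>n<N. F n \<omega>) - s \<omega>)"
  have "(\<lambda>N. Linf_norm M (P N)) \<longlonglongrightarrow> 0" using s by (simp add: Linf_sums_def P_def)
  then have "\<forall>\<^sub>F N in sequentially. Linf_norm M (P N) < 1" by (rule order_tendstoD) simp
  then obtain N0 where N0: "\<And>N. N0 \<le> N \<Longrightarrow> Linf_norm M (P N) < 1"
    by (auto simp: eventually_sequentially)
  have P: "AE \<omega> in M. \<bar>P N \<omega>\<bar> \<le> 1" if "N0 \<le> N" for N
    using AE_le_Linf_norm[of "P N" M]
  proof eventually_elim
    case (elim \<omega>)
    then have "ereal \<bar>P N \<omega>\<bar> \<le> 1" using N0[OF that] by (meson order.trans less_imp_le)
    then show ?case by simp
  qed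
  have "\<exists>k. 0 \<le> k \<and> (AE \<omega> in M. \<bar>F n \<omega>\<bar> \<le> k)" for n
    using s Linf_space_bounded[of "F n" M] unfolding Linf_sums_def by metis
  then obtain k where k: "\<And>n. 0 \<le> k n" "\<And>n. AE \<omega> in M. \<bar>F n \<omega>\<bar> \<le> k n" by metis
  define K where "K = 2 + (\<Sum>n<N0. k n)"
  have F: "AE \<omega> in M. \<bar>F n \<omega>\<bar> \<le> K" for n
  proof (cases "N0 \<le> n")
    case True
    have "AE \<omega> in M. \<bar>P n \<omega>\<bar> \<le> 1" "AE \<omega> in M. \<bar>P (Suc n) \<omega>\<bar> \<le> 1" using P True by auto
    then show ?thesis
    proof eventually_elim
      case (elim \<omega>)
      have "F n \<omega> = P (Suc n) \<omega> - P n \<omega>" by (simp add: P_def)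
      then have "\<bar>F n \<omega>\<bar> \<le> 2" using elim by linarith
      also have "2 \<le> K" using k(1) by (simp add: K_def sum_nonneg)
      finally show ?case .
    qed
  next
    case False
    then have "k n \<le> (\<Sum>n<N0. k n)" using k(1) by (intro member_le_sum) auto
    then have "k n \<le> K" by (simp add: K_def)
    then show ?thesis using k(2)[of n] by (auto elim: eventually_mono)
  qed
  show thesis
  proof (rule that[of K])
    show "0 \<le> K" using k(1) by (simp add: K_def sum_nonneg)
    show "AE \<omega> in M. \<forall>n. \<bar>C n \<omega>\<bar> * \<rho> ^ n \<le> K"
      unfolding AE_all_countable using F \<rho> by (simp add: F_def abs_mult)
  qed
qed

lemma (in prob_space) Linf_sums_power_series:
  assumes c[measurable]: "\<And>n. c n \<in> borel_measurable M"
    and bound: "AE \<omega> in M. \<forall>n. \<bar>c n \<omega>\<bar> * q ^ n \<le> C" and x: "\<bar>x\<bar> < q"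
  shows "Linf_sums M (\<lambda>n \<omega>. c n \<omega> * x ^ n) (\<lambda>\<omega>. \<Sum>n. c n \<omega> * x ^ n)"
proof -
  have q: "0 < q" using x by linarith
  have y: "\<bar>x\<bar> / q < 1" using x q by simp
  have in_Linf: "f \<in> Linf_space M" if "f \<in> borel_measurable M" "AE \<omega> in M. \<bar>f \<omega>\<bar> \<le> k" for f and k :: real
    using Linf_norm_le[OF that] that(1) by (auto simp: Linf_space_def less_top[symmetric] top_ereal_def)
  show ?thesis unfolding Linf_sums_def
  proof (intro conjI allI)
    fix n
    have "AE \<omega> in M. \<bar>c n \<omega> * x ^ n\<bar> \<le> C"
      using bound
    proof eventually_elim
      case (elim \<omega>)
      have "\<bar>c n \<omega> * x ^ n\<bar> \<le> \<bar>c n \<omega>\<bar> * q ^ n"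
        unfolding abs_mult power_abs using x by (intro mult_left_mono power_mono) auto
      then show ?case using elim by (meson order.trans)
    qed
    then show "(\<lambda>\<omega>. c n \<omega> * x ^ n) \<in> Linf_space M" by (rule in_Linf[rotated]) measurable
  next
    have "AE \<omega> in M. \<bar>\<Sum>n. c n \<omega> * x ^ n\<bar> \<le> C / (1 - \<bar>x\<bar> / q)"
      using bound by eventually_elim (rule geometric_bound_summable(2), use q x in auto)
    then show "(\<lambda>\<omega>. \<Sum>n. c n \<omega> * x ^ n) \<in> Linf_space M" by (rule in_Linf[rotated]) measurable
  next
    let ?d = "\<lambda>N \<omega>. (\<Sum>n<N. c n \<omega> * x ^ n) - (\<Sum>n. c n \<omega> * x ^ n)"
    have d: "?d N \<in> borel_measurable M" for N by measurable
    have up: "Linf_norm M (?d N) \<le> ereal (C * (\<bar>x\<bar> / q) ^ N / (1 - \<bar>x\<bar> / q))" for N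
    proof (rule Linf_norm_le[OF d])
      show "AE \<omega> in M. \<bar>?d N \<omega>\<bar> \<le> C * (\<bar>x\<bar> / q) ^ N / (1 - \<bar>x\<bar> / q)"
        using bound by eventually_elim (rule geometric_bound_summable(3), use q x in auto)
    qed
    have "(\<lambda>N. ereal (C * (\<bar>x\<bar> / q) ^ N / (1 - \<bar>x\<bar> / q))) \<longlonglongrightarrow> ereal (C * 0 / (1 - \<bar>x\<bar> / q))"
      using y q by (intro tendsto_ereal tendsto_intros LIMSEQ_power_zero) auto
    then have lim: "(\<lambda>N. ereal (C * (\<bar>x\<bar> / q) ^ N / (1 - \<bar>x\<bar> / q))) \<longlonglongrightarrow> 0"
      by (simp add: zero_ereal_def)
    show "(\<lambda>N. Linf_norm M (?d N)) \<longlonglongrightarrow> 0"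
    proof (rule tendsto_sandwich[OF _ _ tendsto_const lim])
      show "\<forall>\<^sub>F N in sequentially. 0 \<le> Linf_norm M (?d N)"
        by (intro always_eventually allI Linf_norm_nonneg d)
      show "\<forall>\<^sub>F N in sequentially. Linf_norm M (?d N) \<le> ereal (C * (\<bar>x\<bar> / q) ^ N / (1 - \<bar>x\<bar> / q))"
        by (intro always_eventually allI up)
    qed
  qed
qed

lemma Linf_setting_pair_geometric_bound:
  assumes "Linf_setting M A t0 r" "Linf_setting M B t0 r" and \<rho>: "0 < \<rho>" "\<rho> < r"
  obtains K where "0 \<le> K"
    "AE \<omega> in M. (\<forall>n. \<bar>A n \<omega>\<bar> * \<rho> ^ n \<le> K) \<and> (\<forall>n. \<bar>B n \<omega>\<bar> * \<rho> ^ n \<le> K)"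
proof -
  obtain K1 where K1: "0 \<le> K1" "AE \<omega> in M. \<forall>n. \<bar>A n \<omega>\<bar> * \<rho> ^ n \<le> K1"
    using Linf_setting_geometric_bound[OF assms(1) \<rho>] .
  obtain K2 where K2: "0 \<le> K2" "AE \<omega> in M. \<forall>n. \<bar>B n \<omega>\<bar> * \<rho> ^ n \<le> K2"
    using Linf_setting_geometric_bound[OF assms(2) \<rho>] .
  show thesis
  proof (rule that[of "max K1 K2"])
    show "AE \<omega> in M. (\<forall>n. \<bar>A n \<omega>\<bar> * \<rho> ^ n \<le> max K1 K2) \<and> (\<forall>n. \<bar>B n \<omega>\<bar> * \<rho> ^ n \<le> max K1 K2)"
      using K1(2) K2(2) by eventually_elim (auto simp: le_max_iff_disj)
  qed (use K1 in auto)
qed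

lemma Linf_setting_measurable: "Linf_setting M C t0 r \<Longrightarrow> C n \<in> borel_measurable M"
  by (auto simp: Linf_setting_def Linf_space_def)

section \<open>The mean square solution as a power series\<close>

lemma (in prob_space) random_S_series_AE_eq:
  assumes A: "Linf_setting M A t0 r" and B: "Linf_setting M B t0 r" and t: "\<bar>t - t0\<bar> < r"
  shows "AE \<omega> in M. random_power_series M (S_coeff A B c0 c1) t0 t \<omega> = (\<Sum>n. S_coeff A B c0 c1 n \<omega> * (t - t0) ^ n)"
proof -
  obtain \<rho> where \<rho>: "\<bar>t - t0\<bar> < \<rho>" "\<rho> < r" using dense[OF t] by blast
  obtain q where "\<bar>t - t0\<bar> < q" "q < \<rho>" using dense[OF \<rho>(1)] by blast
  with \<rho> have q: "\<bar>t - t0\<bar> < q" "0 < q" "q < \<rho>" "0 < \<rho>" "\<rho> < r" by linarith+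
  obtain K where K: "0 \<le> K" "AE \<omega> in M. (\<forall>n. \<bar>A n \<omega>\<bar> * \<rho> ^ n \<le> K) \<and> (\<forall>n. \<bar>B n \<omega>\<bar> * \<rho> ^ n \<le> K)"
    using Linf_setting_pair_geometric_bound[OF A B q(4,5)] .
  obtain C where C: "0 \<le> C"
    "\<And>(A :: nat \<Rightarrow> 'a \<Rightarrow> real) B c0 c1 \<omega> n. (\<And>n. \<bar>A n \<omega>\<bar> * \<rho> ^ n \<le> K) \<Longrightarrow> (\<And>n. \<bar>B n \<omega>\<bar> * \<rho> ^ n \<le> K) \<Longrightarrow>
       \<bar>S_coeff A B c0 c1 n \<omega>\<bar> * q ^ n \<le> C * (\<bar>c0\<bar> + \<bar>c1\<bar>)"
    using S_coeff_geometric_bound[OF q(2,3) K(1)] by blast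
  have "Linf_sums M (\<lambda>n \<omega>. S_coeff A B c0 c1 n \<omega> * (t - t0) ^ n) (\<lambda>\<omega>. \<Sum>n. S_coeff A B c0 c1 n \<omega> * (t - t0) ^ n)"
  proof (rule Linf_sums_power_series[OF _ _ q(1)])
    show "S_coeff A B c0 c1 n \<in> borel_measurable M" for n
      by (intro S_coeff_measurable Linf_setting_measurable[OF A] Linf_setting_measurable[OF B])
    show "AE \<omega> in M. \<forall>n. \<bar>S_coeff A B c0 c1 n \<omega>\<bar> * q ^ n \<le> C * (\<bar>c0\<bar> + \<bar>c1\<bar>)"
      using K(2) by eventually_elim (intro allI C(2), auto)
  qed
  then show ?thesis by (intro random_power_series_AE_eq exI)
qed

text \<open>The coefficients with the random initial values \<open>Y0\<close>, \<open>Y1\<close> are bounded geometrically by a multiple of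
\<open>\<bar>Y0\<bar> + \<bar>Y1\<bar>\<close>, which lies in \<open>L\<^sup>2\<close>. Hence their power series is twice mean square differentiable,
satisfies the equation for almost every \<open>\<omega>\<close>, and differs from \<open>X\<close> by a solution with zero initial values, which
vanishes.\<close>

lemma (in prob_space) ms_solution_AE_eq:
  assumes A: "Linf_setting M A t0 r" and B: "Linf_setting M B t0 r"
    and Y0: "Y0 \<in> L2_space M" and Y1: "Y1 \<in> L2_space M"
    and X: "ms_solution M {t0 - r<..<t0 + r} (random_power_series M A t0) (random_power_series M B t0) t0 Y0 Y1 X"
    and t: "\<bar>t - t0\<bar> < r"
  shows "AE \<omega> in M. X t \<omega> = Y0 \<omega> * (\<Sum>n. S_coeff A B 1 0 n \<omega> * (t - t0) ^ n)
                           + Y1 \<omega> * (\<Sum>n. S_coeff A B 0 1 n \<omega> * (t - t0) ^ n)"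
proof -
  obtain \<rho> where \<rho>: "\<bar>t - t0\<bar> < \<rho>" "\<rho> < r" using dense[OF t] by blast
  obtain q where q: "\<bar>t - t0\<bar> < q" "q < \<rho>" using dense[OF \<rho>(1)] by blast
  obtain p where "\<bar>t - t0\<bar> < p" "p < q" using dense[OF q(1)] by blast
  with \<rho> q have q: "\<bar>t - t0\<bar> < p" "0 < p" "p < q" "0 < q" "q < \<rho>" "0 < \<rho>" "\<rho> < r" "\<bar>t - t0\<bar> < \<rho>"
    by linarith+
  obtain K where K: "0 \<le> K" and AB: "AE \<omega> in M. (\<forall>n. \<bar>A n \<omega>\<bar> * \<rho> ^ n \<le> K) \<and> (\<forall>n. \<bar>B n \<omega>\<bar> * \<rho> ^ n \<le> K)"
    using Linf_setting_pair_geometric_bound[OF A B q(6,7)] .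
  obtain C where C: "0 \<le> C"
    "\<And>(A :: nat \<Rightarrow> 'a \<Rightarrow> real) B c0 c1 \<omega> n. (\<And>n. \<bar>A n \<omega>\<bar> * \<rho> ^ n \<le> K) \<Longrightarrow> (\<And>n. \<bar>B n \<omega>\<bar> * \<rho> ^ n \<le> K) \<Longrightarrow>
       \<bar>S_coeff A B c0 c1 n \<omega>\<bar> * q ^ n \<le> C * (\<bar>c0\<bar> + \<bar>c1\<bar>)"
    using S_coeff_geometric_bound[OF q(4,5) K] by blast
  note mA = Linf_setting_measurable[OF A] and mB = Linf_setting_measurable[OF B]
  note [measurable] = L2_space_measurable[OF Y0] L2_space_measurable[OF Y1] S_coeff_measurable[of A M B, OF mA mB]
  \<comment> \<open>One series with random initial values replaces the combination of two series with fixed ones.\<close>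
  define y where "y = (\<lambda>n \<omega>. S_coeff A B (Y0 \<omega>) (Y1 \<omega>) n \<omega>)"
  define y' where "y' = (\<lambda>n \<omega>. diffs (\<lambda>n. y n \<omega>) n)"
  define Y where "Y = (\<lambda>s \<omega>. \<Sum>n. y n \<omega> * (s - t0) ^ n)"
  define Y' where "Y' = (\<lambda>s \<omega>. \<Sum>n. y' n \<omega> * (s - t0) ^ n)"
  define Y'' where "Y'' = (\<lambda>s \<omega>. \<Sum>n. diffs (\<lambda>n. y' n \<omega>) n * (s - t0) ^ n)"
  have y_lin: "y n \<omega> = Y0 \<omega> * S_coeff A B 1 0 n \<omega> + Y1 \<omega> * S_coeff A B 0 1 n \<omega>" for n \<omega>
    unfolding y_def by (rule S_coeff_linear)
  have my[measurable]: "y n \<in> borel_measurable M" for n unfolding y_lin[abs_def] by measurable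
  have my'[measurable]: "y' n \<in> borel_measurable M" for n unfolding y'_def diffs_def by measurable
  define G where "G = (\<lambda>\<omega>. C * \<bar>Y0 \<omega>\<bar> + C * \<bar>Y1 \<omega>\<bar>)"
  have G: "G \<in> L2_space M"
  proof -
    have "(\<lambda>\<omega>. \<bar>Y0 \<omega>\<bar>) \<in> L2_space M" "(\<lambda>\<omega>. \<bar>Y1 \<omega>\<bar>) \<in> L2_space M" using Y0 Y1 by (auto simp: L2_space_iff)
    then show ?thesis unfolding G_def by (rule L2_lincomb)
  qed
  have G': "(\<lambda>\<omega>. G \<omega> / (q - p)) \<in> L2_space M" using L2_lincomb[OF G G, of "1 / (q - p)" 0] by simp
  have ybound: "AE \<omega> in M. \<forall>n. \<bar>y n \<omega>\<bar> * q ^ n \<le> G \<omega>"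
    using AB
  proof eventually_elim
    case (elim \<omega>)
    then show ?case using C(2)[of A \<omega> B "Y0 \<omega>" "Y1 \<omega>"] by (simp add: y_def G_def distrib_left)
  qed
  have y'bound: "AE \<omega> in M. \<forall>n. \<bar>y' n \<omega>\<bar> * p ^ n \<le> G \<omega> / (q - p)"
    using ybound
  proof eventually_elim
    case (elim \<omega>)
    show ?case unfolding y'_def using elim q by (intro allI diffs_geometric_bound) auto
  qed
  have YY': "has_ms_derivative M Y (Y' s) s" if "\<bar>s - t0\<bar> \<le> \<bar>t - t0\<bar>" for s
    unfolding Y_def Y'_def y'_def
    by (rule power_series_has_ms_derivative[OF my G ybound]) (use that q in linarith)
  have Y'Y'': "has_ms_derivative M Y' (Y'' s) s" if "\<bar>s - t0\<bar> \<le> \<bar>t - t0\<bar>" for s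
    unfolding Y'_def Y''_def
    by (rule power_series_has_ms_derivative[OF my' G' y'bound]) (use that q in linarith)
  obtain X' X'' where X': "\<And>s. s \<in> {t0 - r<..<t0 + r} \<Longrightarrow> has_ms_derivative M X (X' s) s"
    and X'': "\<And>s. s \<in> {t0 - r<..<t0 + r} \<Longrightarrow> has_ms_derivative M X' (X'' s) s"
    and ode: "\<And>s. s \<in> {t0 - r<..<t0 + r} \<Longrightarrow>
       AE \<omega> in M. X'' s \<omega> + random_power_series M A t0 s \<omega> * X' s \<omega> + random_power_series M B t0 s \<omega> * X s \<omega> = 0"
    and init: "AE \<omega> in M. X t0 \<omega> = Y0 \<omega>" "AE \<omega> in M. X' t0 \<omega> = Y1 \<omega>"
    using X unfolding ms_solution_def by blast
  have inI: "s \<in> {t0 - r<..<t0 + r}" if "\<bar>s - t0\<bar> \<le> \<bar>t - t0\<bar>" for s using that t by auto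
  have rps: "AE \<omega> in M. random_power_series M A t0 s \<omega> = (\<Sum>n. A n \<omega> * (s - t0) ^ n)"
            "AE \<omega> in M. random_power_series M B t0 s \<omega> = (\<Sum>n. B n \<omega> * (s - t0) ^ n)"
    if "\<bar>s - t0\<bar> \<le> \<bar>t - t0\<bar>" for s
    using A B inI[OF that] by (auto intro!: random_power_series_AE_eq simp: Linf_setting_def)
  define L where "L = K / (1 - \<bar>t - t0\<bar> / \<rho>)"
  have L: "\<bar>\<Sum>n. c n * (s - t0) ^ n\<bar> \<le> L" if "\<And>n. \<bar>c n\<bar> * \<rho> ^ n \<le> K" "\<bar>s - t0\<bar> \<le> \<bar>t - t0\<bar>" for c s
  proof -
    have st: "\<bar>s - t0\<bar> / \<rho> \<le> \<bar>t - t0\<bar> / \<rho>" using that q by (intro divide_right_mono) linarith+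
    have t1: "\<bar>t - t0\<bar> / \<rho> < 1" using q by simp
    have "\<bar>\<Sum>n. c n * (s - t0) ^ n\<bar> \<le> K / (1 - \<bar>s - t0\<bar> / \<rho>)"
      by (rule geometric_bound_summable(2)[OF that(1)]) (use that q in linarith)+
    also have "\<dots> \<le> L" unfolding L_def
    proof (rule divide_left_mono[OF _ K])
      show "1 - \<bar>t - t0\<bar> / \<rho> \<le> 1 - \<bar>s - t0\<bar> / \<rho>" using st by linarith
      show "0 < (1 - \<bar>s - t0\<bar> / \<rho>) * (1 - \<bar>t - t0\<bar> / \<rho>)"
        by (rule mult_pos_pos) (use st t1 in linarith)+
    qed
    finally show ?thesis .
  qed
  define Z where "Z = (\<lambda>s \<omega>. X s \<omega> - Y s \<omega>)"
  define Z' where "Z' = (\<lambda>s \<omega>. X' s \<omega> - Y' s \<omega>)"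
  have "AE \<omega> in M. Z t \<omega> = 0"
  proof (rule ms_linear_ODE_zero[where ?t0.0 = t0 and t = t and Z = Z and Z' = Z' and Z'' = "\<lambda>s \<omega>. X'' s \<omega> - Y'' s \<omega>"
        and a = "random_power_series M A t0" and b = "random_power_series M B t0" and K = L])
    fix s assume "s \<in> {s. \<bar>s - t0\<bar> \<le> \<bar>t - t0\<bar>}"
    then have s: "\<bar>s - t0\<bar> \<le> \<bar>t - t0\<bar>" by simp
    show "has_ms_derivative M Z (Z' s) s"
      unfolding Z_def Z'_def by (intro has_ms_derivative_diff X' YY' inI s)
    show "has_ms_derivative M Z' (\<lambda>\<omega>. X'' s \<omega> - Y'' s \<omega>) s"
      unfolding Z'_def by (intro has_ms_derivative_diff X'' Y'Y'' inI s)
    show "AE \<omega> in M. X'' s \<omega> - Y'' s \<omega> + random_power_series M A t0 s \<omega> * Z' s \<omega> + random_power_series M B t0 s \<omega> * Z s \<omega> = 0"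
      using ode[OF inI[OF s]] rps[OF s] AB ybound
    proof eventually_elim
      case (elim \<omega>)
      have smaller: "\<bar>c\<bar> * q ^ n \<le> K" if "\<bar>c\<bar> * \<rho> ^ n \<le> K" for c n
        by (rule order.trans[OF mult_left_mono that]) (use q in \<open>auto intro: power_mono\<close>)
      have "Y'' s \<omega> + (\<Sum>n. A n \<omega> * (s - t0) ^ n) * Y' s \<omega> + (\<Sum>n. B n \<omega> * (s - t0) ^ n) * Y s \<omega> = 0"
        unfolding Y''_def Y'_def Y_def y'_def y_def
        by (rule power_series_solves_ODE[where q = q and K = K and C = "G \<omega>"])
           (use elim smaller s q in \<open>auto simp: y_def\<close>)
      then show ?case using elim(1) unfolding elim(2,3) Z_def Z'_def by (simp add: algebra_simps)
    qed
    show "AE \<omega> in M. \<bar>random_power_series M A t0 s \<omega>\<bar> \<le> L"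
      using rps(1)[OF s] AB by eventually_elim (use L s in auto)
    show "AE \<omega> in M. \<bar>random_power_series M B t0 s \<omega>\<bar> \<le> L"
      using rps(2)[OF s] AB by eventually_elim (use L s in auto)
  next
    have "Y t0 \<omega> = Y0 \<omega>" for \<omega> unfolding Y_def using powser_zero[of "\<lambda>n. y n \<omega>"] by (simp add: y_def)
    then show "AE \<omega> in M. Z t0 \<omega> = 0" using init(1) unfolding Z_def by (auto elim: eventually_mono)
    have "Y' t0 \<omega> = Y1 \<omega>" for \<omega> unfolding Y'_def using powser_zero[of "\<lambda>n. y' n \<omega>"] by (simp add: y_def y'_def diffs_def)
    then show "AE \<omega> in M. Z' t0 \<omega> = 0" using init(2) unfolding Z'_def by (auto elim: eventually_mono)
  qed
  then show ?thesis using AB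
  proof eventually_elim
    case (elim \<omega>)
    have sm: "summable (\<lambda>n. S_coeff A B c0 c1 n \<omega> * (t - t0) ^ n)" for c0 c1
      by (rule summable_norm_cancel, rule geometric_bound_summable(1)[where q = q])
         (use C(2)[of A \<omega> B c0 c1] elim q in auto)
    have "Y t \<omega> = (\<Sum>n. Y0 \<omega> * (S_coeff A B 1 0 n \<omega> * (t - t0) ^ n) + Y1 \<omega> * (S_coeff A B 0 1 n \<omega> * (t - t0) ^ n))"
      unfolding Y_def y_lin by (simp add: algebra_simps)
    also have "\<dots> = Y0 \<omega> * (\<Sum>n. S_coeff A B 1 0 n \<omega> * (t - t0) ^ n) + Y1 \<omega> * (\<Sum>n. S_coeff A B 0 1 n \<omega> * (t - t0) ^ n)"
      using sm by (simp add: suminf_add[symmetric] suminf_mult summable_mult)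
    finally show ?case using elim(1) by (simp add: Z_def)
  qed
qed

section \<open>Density of an affine function of an independent variable\<close>

text \<open>Both measures agree on rectangles, by independence of the preimages.\<close>

lemma (in prob_space) indep_elements_distr:
  assumes "indep_elements M N U K V"
  shows "distr M K V \<Otimes>\<^sub>M distr M N U = distr M (K \<Otimes>\<^sub>M N) (\<lambda>\<omega>. (V \<omega>, U \<omega>))"
proof -
  have U[measurable]: "U \<in> measurable M N" and V[measurable]: "V \<in> measurable M K"
    and ind: "indep_set (sets (vimage_algebra (space M) U N)) (sets (vimage_algebra (space M) V K))"
    using assms by (auto simp: indep_elements_def)
  interpret U: prob_space "distr M N U" by (rule prob_space_distr) measurable
  interpret V: prob_space "distr M K V" by (rule prob_space_distr) measurable
  show ?thesis
  proof (rule pair_measure_eqI)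
    show "sigma_finite_measure (distr M K V)" "sigma_finite_measure (distr M N U)" by unfold_locales
    fix A B assume "A \<in> sets (distr M K V)" "B \<in> sets (distr M N U)"
    then have A[measurable]: "A \<in> sets K" and B[measurable]: "B \<in> sets N" by auto
    let ?A = "V -` A \<inter> space M" and ?B = "U -` B \<inter> space M"
    have "?B \<in> sets (vimage_algebra (space M) U N)" "?A \<in> sets (vimage_algebra (space M) V K)"
      using A B by (auto intro: in_vimage_algebra)
    then have "prob (?B \<inter> ?A) = prob ?B * prob ?A" by (rule indep_setD[OF ind])
    then have "emeasure M (?A \<inter> ?B) = emeasure M ?A * emeasure M ?B"
      by (simp add: emeasure_eq_measure ennreal_mult Int_commute mult.commute)
    moreover have "(\<lambda>\<omega>. (V \<omega>, U \<omega>)) -` (A \<times> B) \<inter> space M = ?A \<inter> ?B" by auto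
    ultimately show "emeasure (distr M K V) A * emeasure (distr M N U) B
        = emeasure (distr M (K \<Otimes>\<^sub>M N) (\<lambda>\<omega>. (V \<omega>, U \<omega>))) (A \<times> B)"
      by (simp add: emeasure_distr)
  qed (simp cong: sets_pair_measure_cong)
qed

text \<open>By independence the pair has a product law, so \<open>V\<close> may be frozen at a value \<open>v\<close>. Then the variable
\<open>a v + b v U\<close> has density \<open>f ((x - a v) / b v) / \<bar>b v\<bar>\<close> by an affine substitution, and averaging over
\<open>v\<close> with Tonelli's theorem gives the density of the mixture.\<close>

lemma (in prob_space) distributed_indep_affine:
  fixes U :: "'a \<Rightarrow> real" and a b :: "'c \<Rightarrow> real"
  assumes ind: "indep_elements M borel U K V" and U: "distributed M lborel U f"
    and a[measurable]: "a \<in> borel_measurable K" and b[measurable]: "b \<in> borel_measurable K"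
    and b0: "AE \<omega> in M. b (V \<omega>) \<noteq> 0"
  shows "distributed M lborel (\<lambda>\<omega>. a (V \<omega>) + b (V \<omega>) * U \<omega>)
           (\<lambda>x. \<integral>\<^sup>+ \<omega>. f ((x - a (V \<omega>)) / b (V \<omega>)) * ennreal (1 / \<bar>b (V \<omega>)\<bar>) \<partial>M)"
proof -
  have mU[measurable]: "U \<in> borel_measurable M" and V[measurable]: "V \<in> measurable M K"
    using ind by (auto simp: indep_elements_def)
  have f[measurable]: "f \<in> borel_measurable borel" and dU: "distr M lborel U = density lborel f"
    using U by (auto simp: distributed_def)
  have dU': "distr M borel U = density lborel f"
    using dU by (simp cong: distr_cong)
  define Q where "Q = distr M K V"
  have sQ[measurable_cong]: "sets Q = sets K" by (simp add: Q_def)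
  interpret Q: prob_space Q unfolding Q_def by (rule prob_space_distr) measurable
  interpret QL: pair_sigma_finite Q lborel by unfold_locales
  interpret D: prob_space "density lborel f" unfolding dU'[symmetric] by (rule prob_space_distr) measurable
  let ?X = "\<lambda>\<omega>. a (V \<omega>) + b (V \<omega>) * U \<omega>"
  let ?k = "\<lambda>x v. f ((x - a v) / b v) * ennreal (1 / \<bar>b v\<bar>)"
  have b0Q: "AE v in Q. b v \<noteq> 0" unfolding Q_def using b0 by (subst AE_distr_iff) auto
  have subst: "(\<integral>\<^sup>+u. f u * indicator E (a v + b v * u) \<partial>lborel) = (\<integral>\<^sup>+x. ?k x v * indicator E x \<partial>lborel)"
    if [measurable]: "E \<in> sets borel" and nz: "b v \<noteq> 0" for E v
  proof -
    have "(\<integral>\<^sup>+u. f u * indicator E (a v + b v * u) \<partial>lborel)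
        = ennreal \<bar>1 / b v\<bar> * (\<integral>\<^sup>+x. f (- a v / b v + 1 / b v * x) * indicator E (a v + b v * (- a v / b v + 1 / b v * x)) \<partial>lborel)"
      using nz by (intro nn_integral_real_affine) auto
    also have "\<dots> = (\<integral>\<^sup>+x. ennreal \<bar>1 / b v\<bar> * (f (- a v / b v + 1 / b v * x) * indicator E (a v + b v * (- a v / b v + 1 / b v * x))) \<partial>lborel)"
      by (rule nn_integral_cmult[symmetric]) measurable
    also have "\<dots> = (\<integral>\<^sup>+x. ?k x v * indicator E x \<partial>lborel)"
    proof (rule nn_integral_cong)
      fix x
      have "- a v / b v + 1 / b v * x = (x - a v) / b v" by (simp add: diff_divide_distrib)
      moreover have "a v + b v * ((x - a v) / b v) = x" using nz by simp
      ultimately show "ennreal \<bar>1 / b v\<bar> * (f (- a v / b v + 1 / b v * x) * indicator E (a v + b v * (- a v / b v + 1 / b v * x))) = ?k x v * indicator E x"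
        by (simp add: mult_ac)
    qed
    finally show ?thesis .
  qed
  have g_eq: "(\<integral>\<^sup>+ \<omega>. ?k x (V \<omega>) \<partial>M) = (\<integral>\<^sup>+ v. ?k x v \<partial>Q)" for x
    unfolding Q_def by (rule nn_integral_distr[symmetric]) measurable
  have mg: "(\<lambda>x. \<integral>\<^sup>+ v. ?k x v \<partial>Q) \<in> borel_measurable borel" by measurable
  show ?thesis unfolding distributed_def g_eq
  proof (intro conjI)
    show "distr M lborel ?X = density lborel (\<lambda>x. \<integral>\<^sup>+ v. ?k x v \<partial>Q)"
    proof (rule measure_eqI)
      fix E assume "E \<in> sets (distr M lborel ?X)"
      then have E[measurable]: "E \<in> sets borel" by simp
      have "emeasure (distr M lborel ?X) E = (\<integral>\<^sup>+\<omega>. indicator E (a (V \<omega>) + b (V \<omega>) * U \<omega>) \<partial>M)"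
        by (simp add: nn_integral_indicator[symmetric] nn_integral_distr del: nn_integral_indicator)
      also have "\<dots> = (\<integral>\<^sup>+z. indicator E (a (fst z) + b (fst z) * snd z) \<partial>distr M (K \<Otimes>\<^sub>M borel) (\<lambda>\<omega>. (V \<omega>, U \<omega>)))"
        by (subst nn_integral_distr) auto
      also have "\<dots> = (\<integral>\<^sup>+z. indicator E (a (fst z) + b (fst z) * snd z) \<partial>(Q \<Otimes>\<^sub>M density lborel f))"
        unfolding indep_elements_distr[OF ind, symmetric] dU' Q_def ..
      also have "\<dots> = (\<integral>\<^sup>+v. \<integral>\<^sup>+u. indicator E (a v + b v * u) \<partial>density lborel f \<partial>Q)"
        by (subst D.nn_integral_fst[symmetric]) simp_all
      also have "\<dots> = (\<integral>\<^sup>+v. \<integral>\<^sup>+u. f u * indicator E (a v + b v * u) \<partial>lborel \<partial>Q)"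
        by (intro nn_integral_cong nn_integral_density) simp_all
      also have "\<dots> = (\<integral>\<^sup>+v. \<integral>\<^sup>+x. ?k x v * indicator E x \<partial>lborel \<partial>Q)"
        using b0Q by (intro nn_integral_cong_AE) (auto elim!: eventually_mono simp: subst)
      also have "\<dots> = (\<integral>\<^sup>+x. \<integral>\<^sup>+v. ?k x v * indicator E x \<partial>Q \<partial>lborel)"
        by (rule QL.Fubini'[symmetric]) simp
      also have "\<dots> = (\<integral>\<^sup>+x. (\<integral>\<^sup>+v. ?k x v \<partial>Q) * indicator E x \<partial>lborel)"
        by (intro nn_integral_cong nn_integral_multc) simp
      also have "\<dots> = emeasure (density lborel (\<lambda>x. \<integral>\<^sup>+ v. ?k x v \<partial>Q)) E"
        using mg by (subst emeasure_density) auto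
      finally show "emeasure (distr M lborel ?X) E = emeasure (density lborel (\<lambda>x. \<integral>\<^sup>+ v. ?k x v \<partial>Q)) E" .
    qed simp
  qed (use mg in simp_all)
qed

section \<open>The density of the solution\<close>

theorem theorem3p3:
  fixes M :: "'a measure"
    and t0 r t :: real
    and A B :: "nat \<Rightarrow> 'a \<Rightarrow> real"
    and Y0 Y1 :: "'a \<Rightarrow> real"
    and X :: "real \<Rightarrow> 'a \<Rightarrow> real"
    and fY0 :: "real \<Rightarrow> ennreal"
  assumes "prob_space M" and "complete_measure M"
    and "0 < r"
    and "Linf_setting M A t0 r" and "Linf_setting M B t0 r"
    and "Y0 \<in> L2_space M" and "Y1 \<in> L2_space M"
    and "ms_solution M {t0 - r<..<t0 + r} (random_power_series M A t0) (random_power_series M B t0)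
           t0 Y0 Y1 X"
    and "t \<in> {t0 - r<..<t0 + r}"
    and "AE \<omega> in M. S0 M A B t0 t \<omega> \<noteq> 0"
    and "distributed M lborel Y0 fY0"
    and "indep_elements M borel Y0
           (borel \<Otimes>\<^sub>M (PiM UNIV (\<lambda>_. borel) \<Otimes>\<^sub>M PiM UNIV (\<lambda>_. borel)))
           (\<lambda>\<omega>. (Y1 \<omega>, (\<lambda>n. A n \<omega>), (\<lambda>n. B n \<omega>)))"
  shows "distributed M lborel (X t)
           (\<lambda>x. \<integral>\<^sup>+ \<omega>. fY0 ((x - Y1 \<omega> * S1 M A B t0 t \<omega>) / S0 M A B t0 t \<omega>)
                       * ennreal (1 / \<bar>S0 M A B t0 t \<omega>\<bar>) \<partial>M)"
proof -
  interpret prob_space M by fact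
  note A = assms(4) and B = assms(5)
  have t: "\<bar>t - t0\<bar> < r" using assms(9) by auto
  define K :: "(real \<times> (nat \<Rightarrow> real) \<times> (nat \<Rightarrow> real)) measure"
    where "K = borel \<Otimes>\<^sub>M (PiM UNIV (\<lambda>_. borel) \<Otimes>\<^sub>M PiM UNIV (\<lambda>_. borel))"
  define V where "V = (\<lambda>\<omega>. (Y1 \<omega>, (\<lambda>n. A n \<omega>), (\<lambda>n. B n \<omega>)))"
  have ind: "indep_elements M borel Y0 K V" using assms(12) by (simp add: K_def V_def)
  \<comment> \<open>\<open>\<Phi> c0 c1\<close> is the series \<open>S\<^sub>0\<close> or \<open>S\<^sub>1\<close> as a function of the input parameters themselves, so that its value at \<open>V \<omega>\<close> is visibly determined by what is independent of \<open>Y0\<close>.\<close>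
  define \<Phi> where "\<Phi> = (\<lambda>c0 c1 (v :: real \<times> (nat \<Rightarrow> real) \<times> (nat \<Rightarrow> real)). \<Sum>n. S_coeff (\<lambda>n v. fst (snd v) n) (\<lambda>n v. snd (snd v) n) c0 c1 n v * (t - t0) ^ n)"
  have coord: "(\<lambda>v. fst (snd v) n) \<in> borel_measurable K" "(\<lambda>v. snd (snd v) n) \<in> borel_measurable K" for n
    unfolding K_def by measurable
  have m\<Phi>[measurable]: "\<Phi> c0 c1 \<in> borel_measurable K" for c0 c1
  proof -
    note [measurable] = S_coeff_measurable[of "\<lambda>n v. fst (snd v) n" K "\<lambda>n v. snd (snd v) n", OF coord]
    show ?thesis unfolding \<Phi>_def by measurable
  qed
  have \<Phi>V: "\<Phi> c0 c1 (V \<omega>) = (\<Sum>n. S_coeff A B c0 c1 n \<omega> * (t - t0) ^ n)" for c0 c1 \<omega>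
  proof -
    have "S_coeff (\<lambda>n v. fst (snd v) n) (\<lambda>n v. snd (snd v) n) c0 c1 n (V \<omega>) = S_coeff A B c0 c1 n \<omega>" for n
      by (rule S_coeff_cong) (simp_all add: V_def)
    then show ?thesis by (simp add: \<Phi>_def)
  qed
  have S0: "AE \<omega> in M. S0 M A B t0 t \<omega> = \<Phi> 1 0 (V \<omega>)" and S1: "AE \<omega> in M. S1 M A B t0 t \<omega> = \<Phi> 0 1 (V \<omega>)"
    unfolding S0_def S1_def \<Phi>V by (rule random_S_series_AE_eq[OF A B t])+
  define a where "a = (\<lambda>v. fst v * \<Phi> 0 1 v)"
  have [measurable]: "fst \<in> borel_measurable K" unfolding K_def by measurable
  have ma: "a \<in> borel_measurable K" unfolding a_def by measurable
  have nz: "AE \<omega> in M. \<Phi> 1 0 (V \<omega>) \<noteq> 0" using S0 assms(10) by eventually_elim simp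
  note main = distributed_indep_affine[OF ind assms(11) ma m\<Phi> nz]
  have X: "AE \<omega> in M. X t \<omega> = a (V \<omega>) + \<Phi> 1 0 (V \<omega>) * Y0 \<omega>"
    using ms_solution_AE_eq[OF A B assms(6-8) t]
    by eventually_elim (simp add: \<Phi>V a_def, simp add: V_def)
  have mX: "X t \<in> borel_measurable M"
    using assms(8,9) unfolding ms_solution_def by (blast intro: L2_space_measurable has_ms_derivativeD(2))
  have dens: "(\<integral>\<^sup>+ \<omega>. fY0 ((x - Y1 \<omega> * S1 M A B t0 t \<omega>) / S0 M A B t0 t \<omega>) * ennreal (1 / \<bar>S0 M A B t0 t \<omega>\<bar>) \<partial>M)
      = (\<integral>\<^sup>+ \<omega>. fY0 ((x - a (V \<omega>)) / \<Phi> 1 0 (V \<omega>)) * ennreal (1 / \<bar>\<Phi> 1 0 (V \<omega>)\<bar>) \<partial>M)" for x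
  proof (rule nn_integral_cong_AE)
    have aV: "a (V \<omega>) = Y1 \<omega> * \<Phi> 0 1 (V \<omega>)" for \<omega> by (simp add: a_def) (simp add: V_def)
    show "AE \<omega> in M. fY0 ((x - Y1 \<omega> * S1 M A B t0 t \<omega>) / S0 M A B t0 t \<omega>) * ennreal (1 / \<bar>S0 M A B t0 t \<omega>\<bar>)
       = fY0 ((x - a (V \<omega>)) / \<Phi> 1 0 (V \<omega>)) * ennreal (1 / \<bar>\<Phi> 1 0 (V \<omega>)\<bar>)"
      using S0 S1 by eventually_elim (simp add: aV)
  qed
  have "distr M lborel (X t) = distr M lborel (\<lambda>\<omega>. a (V \<omega>) + \<Phi> 1 0 (V \<omega>) * Y0 \<omega>)"
    using X mX main by (intro distr_cong_AE) (auto simp: distributed_def)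
  then show ?thesis using main mX unfolding dens distributed_def by simp
qed

end
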